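(* Let $H$ be an infinite-dimensional separable complex Hilbert space and let $T\in\mathcal{B}(H)$ have polar decomposition $T=V|T|$. Then $\mathcal{R}_T=\mathcal{R}_{|T|}$ if and only if $V\in W^*(|T|)=\{|T|\}''$.
   Context: $\mathcal{B}(H)$ denotes the bounded linear operators on $H$; $|T|=(T^*T)^{1/2}$; in the polar decomposition, $V$ is the unique partial isometry with $T=V|T|$ and $N(V)=N(T)$ ($N$ denotes the kernel). A closed subspace $M\subseteq H$ reduces $T$ if $T(M)\subseteq M$ and $T^*(M)\subseteq M$; $\mathcal{R}_T$ is the set of all closed subspaces reducing $T$. For $\mathcal{S}\subseteq\mathcal{B}(H)$, $\mathcal{S}'=\{A\in\mathcal{B}(H): AS=SA\text{ for all }S\in\mathcal{S}\}$ and $\mathcal{S}''=(\mathcal{S}')'$. $W^*(|T|)$ is the von Neumann algebra generated by $|T|$, i.e. the smallest unital $*$-subalgebra of $\mathcal{B}(H)$ that is closed in the weak operator topology and contains $|T|$; it equals $\{|T|\}''$. *)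

theory Defs
  imports "HOL-Analysis.Analysis"
begin

section \<open>Complex Hilbert spaces\<close>

text \<open>
  A complex inner product space, linear in the first argument of \<open>cinner\<close>. The underlying real
  structure is the one obtained by restriction of scalars, with real inner product
  \<open>Re (cinner x y)\<close>; hence the norm of the superclass is \<open>sqrt (Re (cinner x x))\<close> and \<open>closed\<close>,
  \<open>bounded_linear\<close> etc. have their usual Hilbert space meaning. Positive definiteness of \<open>cinner\<close>
  is inherited from \<open>inner\<close>.
\<close>

class complex_inner = real_inner +
  fixes scaleC :: "complex \<Rightarrow> 'a \<Rightarrow> 'a"  (infixr \<open>*\<^sub>C\<close> 75)
    and cinner :: "'a \<Rightarrow> 'a \<Rightarrow> complex"
  assumes scaleC_add_right: "a *\<^sub>C (x + y) = a *\<^sub>C x + a *\<^sub>C y"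
    and scaleC_add_left: "(a + b) *\<^sub>C x = a *\<^sub>C x + b *\<^sub>C x"
    and scaleC_scaleC: "a *\<^sub>C b *\<^sub>C x = (a * b) *\<^sub>C x"
    and scaleC_one: "1 *\<^sub>C x = x"
    and scaleC_complex_of_real: "complex_of_real r *\<^sub>C x = r *\<^sub>R x"
    and cinner_commute: "cinner x y = cnj (cinner y x)"
    and cinner_add_left: "cinner (x + y) z = cinner x z + cinner y z"
    and cinner_scaleC_left: "cinner (a *\<^sub>C x) y = a * cinner x y"
    and Re_cinner: "Re (cinner x y) = inner x y"

class complex_hilbert_space = complex_inner + banach

global_interpretation complex_vector:
  vector_space "scaleC :: complex \<Rightarrow> 'a \<Rightarrow> 'a::complex_inner"
  by unfold_locales
    (simp_all add: scaleC_add_right scaleC_add_left scaleC_scaleC scaleC_one)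

definition infinite_dimensional :: "'a::complex_inner itself \<Rightarrow> bool" where
  "infinite_dimensional _ \<longleftrightarrow>
     \<not> (\<exists>B :: 'a set. finite B \<and> complex_vector.span B = UNIV)"


section \<open>Bounded operators\<close>

definition bounded_clinear :: "('a::complex_inner \<Rightarrow> 'a) \<Rightarrow> bool" where
  "bounded_clinear A \<longleftrightarrow> bounded_linear A \<and> (\<forall>c x. A (c *\<^sub>C x) = c *\<^sub>C A x)"

definition bounded_ops :: "('a::complex_inner \<Rightarrow> 'a) set"  (\<open>\<B>\<close>) where
  "\<B> = {A. bounded_clinear A}"

text \<open>Existence and uniqueness of the adjoint on a complex Hilbert space is the Riesz theorem.\<close>

definition adj :: "('a::complex_hilbert_space \<Rightarrow> 'a) \<Rightarrow> 'a \<Rightarrow> 'a" where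
  "adj A = (THE B. B \<in> \<B> \<and> (\<forall>x y. cinner (A x) y = cinner x (B y)))"

definition positive_op :: "('a::complex_inner \<Rightarrow> 'a) \<Rightarrow> bool" where
  "positive_op A \<longleftrightarrow> A \<in> \<B> \<and> (\<forall>x. cinner (A x) x \<in> \<real>\<^sub>\<ge>\<^sub>0)"

text \<open>The positive square root; it exists and is unique for every positive operator.\<close>

definition sqrt_op :: "('a::complex_hilbert_space \<Rightarrow> 'a) \<Rightarrow> 'a \<Rightarrow> 'a" where
  "sqrt_op A = (THE S. positive_op S \<and> S \<circ> S = A)"

definition abs_op :: "('a::complex_hilbert_space \<Rightarrow> 'a) \<Rightarrow> 'a \<Rightarrow> 'a" where
  "abs_op T = sqrt_op (adj T \<circ> T)"

definition op_kernel :: "('a::complex_inner \<Rightarrow> 'a) \<Rightarrow> 'a set" where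
  "op_kernel A = {x. A x = 0}"

definition partial_isometry :: "('a::complex_hilbert_space \<Rightarrow> 'a) \<Rightarrow> bool" where
  "partial_isometry V \<longleftrightarrow> V \<in> \<B> \<and>
     (\<forall>x. (\<forall>y \<in> op_kernel V. cinner x y = 0) \<longrightarrow> norm (V x) = norm x)"

definition polar_decomposition ::
    "('a::complex_hilbert_space \<Rightarrow> 'a) \<Rightarrow> ('a \<Rightarrow> 'a) \<Rightarrow> bool" where
  "polar_decomposition T V \<longleftrightarrow>
     partial_isometry V \<and> T = V \<circ> abs_op T \<and> op_kernel V = op_kernel T"

definition reducing_subspaces :: "('a::complex_hilbert_space \<Rightarrow> 'a) \<Rightarrow> 'a set set" where
  "reducing_subspaces T =
     {M. closed M \<and> complex_vector.subspace M \<and> T ` M \<subseteq> M \<and> adj T ` M \<subseteq> M}"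


section \<open>Commutants and von Neumann algebras\<close>

definition commutant :: "('a::complex_inner \<Rightarrow> 'a) set \<Rightarrow> ('a \<Rightarrow> 'a) set" where
  "commutant \<S> = {A \<in> \<B>. \<forall>S \<in> \<S>. A \<circ> S = S \<circ> A}"

text \<open>
  The weak operator topology, with underlying set \<open>\<B>\<close>: the coarsest topology making all maps
  \<open>A \<mapsto> cinner (A x) y\<close> continuous.
\<close>

definition weak_operator_topology :: "('a::complex_inner \<Rightarrow> 'a) topology" where
  "weak_operator_topology =
     topology_generated_by {{A \<in> \<B>. cinner (A x) y \<in> U} | x y U. open U}"

definition unital_star_subalgebra :: "('a::complex_hilbert_space \<Rightarrow> 'a) set \<Rightarrow> bool" where
  "unital_star_subalgebra \<A> \<longleftrightarrow> \<A> \<subseteq> \<B> \<and> id \<in> \<A> \<and>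
     (\<forall>A \<in> \<A>. \<forall>B \<in> \<A>. (\<lambda>x. A x + B x) \<in> \<A>) \<and>
     (\<forall>c. \<forall>A \<in> \<A>. (\<lambda>x. c *\<^sub>C A x) \<in> \<A>) \<and>
     (\<forall>A \<in> \<A>. \<forall>B \<in> \<A>. A \<circ> B \<in> \<A>) \<and>
     (\<forall>A \<in> \<A>. adj A \<in> \<A>)"

definition von_neumann_algebra :: "('a::complex_hilbert_space \<Rightarrow> 'a) set \<Rightarrow> bool" where
  "von_neumann_algebra \<A> \<longleftrightarrow>
     unital_star_subalgebra \<A> \<and> closedin weak_operator_topology \<A>"

definition generated_von_neumann_algebra ::
    "('a::complex_hilbert_space \<Rightarrow> 'a) \<Rightarrow> ('a \<Rightarrow> 'a) set"  (\<open>W\<^sup>*\<close>) where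
  "W\<^sup>* A = \<Inter> {\<A>. von_neumann_algebra \<A> \<and> A \<in> \<A>}"

end

theory Submission
  imports Defs
begin

text \<open>
  Let \<open>S = \<bar>T\<bar>\<close>. A closed subspace reduces an operator iff its projection commutes with it, and
  whatever commutes with \<open>T\<close> and \<open>T\<^sup>*\<close> commutes with \<open>S\<close>; so \<open>\<R>\<^sub>T \<subseteq> \<R>\<^sub>S\<close> always holds, and
  \<open>V \<in> {S}''\<close> gives the other inclusion since \<open>T = V S\<close>. Conversely, if \<open>\<R>\<^sub>T = \<R>\<^sub>S\<close>, then \<open>T\<close>
  commutes with all projections in \<open>{S}'\<close>. Every \<open>0 \<le> X \<le> 1\<close> in \<open>{S}'\<close> has a binary expansion
  \<open>X = \<Sum>k. 2\<^sup>-\<^sup>k P\<^sub>k\<close> with projections \<open>P\<^sub>k\<close> in \<open>{S}'\<close>, which replaces the spectral theorem and shows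
  that \<open>T\<close> commutes with \<open>{S}'\<close>. Hence so does \<open>V\<close>, on the range of \<open>S\<close> because \<open>T = V S\<close> and on the
  kernel of \<open>S\<close> because \<open>V\<close> vanishes there. The equality \<open>W\<^sup>*(S) = {S}''\<close> is von Neumann's
  bicommutant theorem.
\<close>

section \<open>Orthogonal projections and adjoints\<close>

lemma cinner_scaleC_right: "cinner x (c *\<^sub>C y) = cnj c * cinner x y"
  by (metis cinner_commute cinner_scaleC_left complex_cnj_mult)

lemma inner_scaleC_left: "inner (c *\<^sub>C x) y = inner x (cnj c *\<^sub>C y)"
  by (metis Re_cinner cinner_scaleC_left cinner_scaleC_right complex_cnj_cnj)

lemma scaleC_uminus_left: "(- c) *\<^sub>C x = - (c *\<^sub>C x)"
  by (rule complex_vector.scale_minus_left)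

lemma scaleC_uminus_right: "c *\<^sub>C (- x) = - (c *\<^sub>C x)"
  by (rule complex_vector.scale_minus_right)

lemma scaleC_diff_right: "c *\<^sub>C (x - y) = c *\<^sub>C x - c *\<^sub>C y"
  by (rule complex_vector.scale_right_diff_distrib)

lemma inner_imaginary_left: "inner (\<i> *\<^sub>C x) y = - inner x (\<i> *\<^sub>C y)"
  by (simp add: inner_scaleC_left scaleC_uminus_left)

lemma scaleC_scaleR_commute: "c *\<^sub>C (r *\<^sub>R x) = r *\<^sub>R (c *\<^sub>C x)"
  by (simp add: scaleC_complex_of_real[symmetric] scaleC_scaleC mult.commute)

lemma norm_scaleC: "norm (c *\<^sub>C x) = cmod c * norm x"
proof -
  have "(norm (c *\<^sub>C x))\<^sup>2 = inner x ((cnj c * c) *\<^sub>C x)"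
    by (simp add: power2_norm_eq_inner inner_scaleC_left scaleC_scaleC)
  also have "cnj c * c = complex_of_real ((cmod c)\<^sup>2)"
    by (metis complex_norm_square mult.commute of_real_power)
  also have "inner x (complex_of_real ((cmod c)\<^sup>2) *\<^sub>C x) = (cmod c * norm x)\<^sup>2"
    by (simp only: scaleC_complex_of_real inner_scaleR_right power2_norm_eq_inner power_mult_distrib)
  finally show ?thesis
    by (simp add: power2_eq_iff_nonneg)
qed

lemma bounded_linear_scaleC: "bounded_linear (\<lambda>x. c *\<^sub>C x)"
  by (rule bounded_linear_intro[where K = "cmod c"])
    (simp_all add: scaleC_add_right scaleC_scaleR_commute norm_scaleC mult.commute)

text \<open>Reduces adjoints and positivity of complex linear operators to the real inner product.\<close>

lemma cinner_conv_inner: "cinner x y = Complex (inner x y) (- inner (\<i> *\<^sub>C x) y)"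
  by (simp add: complex_eq_iff Re_cinner[symmetric] cinner_scaleC_left)

section \<open>Algebra of bounded complex-linear operators\<close>

lemma bounded_opsI:
  assumes "\<And>x y. A (x + y) = A x + A y" and "\<And>c x. A (c *\<^sub>C x) = c *\<^sub>C A x"
    and "\<And>x. norm (A x) \<le> norm x * K"
  shows "A \<in> \<B>"
proof -
  have "bounded_linear A"
    using assms by (intro bounded_linear_intro[where K = K])
      (auto simp: scaleC_complex_of_real[symmetric])
  then show ?thesis
    using assms(2) by (simp add: bounded_ops_def bounded_clinear_def)
qed

lemma ops_bounded_linear: "A \<in> \<B> \<Longrightarrow> bounded_linear A"
  by (simp add: bounded_ops_def bounded_clinear_def)

lemma ops_scaleC: "A \<in> \<B> \<Longrightarrow> A (c *\<^sub>C x) = c *\<^sub>C A x"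
  by (simp add: bounded_ops_def bounded_clinear_def)

lemma ops_simps:
  assumes "A \<in> \<B>"
  shows "A 0 = 0" "A (x + y) = A x + A y" "A (x - y) = A x - A y" "A (- x) = - A x"
    "A (r *\<^sub>R x) = r *\<^sub>R A x" "A (sum g F) = (\<Sum>i\<in>F. A (g i))"
proof -
  interpret bounded_linear A using assms by (rule ops_bounded_linear)
  show "A 0 = 0" "A (x + y) = A x + A y" "A (x - y) = A x - A y" "A (- x) = - A x"
    "A (r *\<^sub>R x) = r *\<^sub>R A x" "A (sum g F) = (\<Sum>i\<in>F. A (g i))"
    by (simp_all add: zero add diff neg scaleR sum)
qed

lemma ops_norm_le:
  assumes "A \<in> \<B>"
  obtains K where "K > 0" "\<And>x. norm (A x) \<le> norm x * K"
  using bounded_linear.pos_bounded[OF ops_bounded_linear[OF assms]] by blast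

lemma ops_tendsto:
  "A \<in> \<B> \<Longrightarrow> (f \<longlongrightarrow> l) F \<Longrightarrow> ((\<lambda>i. A (f i)) \<longlongrightarrow> A l) F"
  by (rule bounded_linear.tendsto[OF ops_bounded_linear])

lemma ops_ident: "(\<lambda>x. x) \<in> \<B>"
  by (rule bounded_opsI[where K = 1]) auto

lemma ops_comp: "A \<in> \<B> \<Longrightarrow> B \<in> \<B> \<Longrightarrow> (\<lambda>x. A (B x)) \<in> \<B>"
  by (simp add: bounded_ops_def bounded_clinear_def bounded_linear_compose)

lemma ops_plus: "A \<in> \<B> \<Longrightarrow> B \<in> \<B> \<Longrightarrow> (\<lambda>x. A x + B x) \<in> \<B>"
  by (simp add: bounded_ops_def bounded_clinear_def bounded_linear_add scaleC_add_right)

lemma ops_minus: "A \<in> \<B> \<Longrightarrow> B \<in> \<B> \<Longrightarrow> (\<lambda>x. A x - B x) \<in> \<B>"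
  by (simp add: bounded_ops_def bounded_clinear_def bounded_linear_sub scaleC_diff_right)

lemma ops_multC: "A \<in> \<B> \<Longrightarrow> (\<lambda>x. c *\<^sub>C A x) \<in> \<B>"
  by (simp add: bounded_ops_def bounded_clinear_def scaleC_scaleC mult.commute
      bounded_linear_compose[OF bounded_linear_scaleC])

lemma ops_multR: "A \<in> \<B> \<Longrightarrow> (\<lambda>x. r *\<^sub>R A x) \<in> \<B>"
  using ops_multC[of A "complex_of_real r"] by (simp add: scaleC_complex_of_real)

text \<open>First-order optimality: near \<open>t = 0\<close> the linear term dominates the
  quadratic one. This serves both the minimisation of a distance and Cauchy-Schwarz for semidefinite
  forms.\<close>

lemma eq_0_if_linear_le_quadratic:
  fixes s c :: real
  assumes "\<And>t. 2 * t * s \<le> t\<^sup>2 * c"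
  shows "s = 0"
proof (rule ccontr)
  assume s: "s \<noteq> 0"
  define b where "b = \<bar>c\<bar> + 1"
  have b: "b > 0" "c < b" by (auto simp: b_def)
  have "2 * (s / b) * s \<le> (s / b)\<^sup>2 * c" by (rule assms)
  then have "2 * b * s\<^sup>2 \<le> c * s\<^sup>2"
    using b by (simp add: field_simps power2_eq_square)
  then have "2 * b \<le> c" using s by simp
  then show False using b by linarith
qed

text \<open>The projection theorem in the Hilbert space of tuples indexed by \<open>I\<close>. The tuples appearing
  in the bicommutant theorem are the restrictions of operators to a finite set of vectors.\<close>

lemma least_squares_approximation:
  fixes K :: "('i \<Rightarrow> 'a::{real_inner,banach}) set" and y :: "'i \<Rightarrow> 'a"
  assumes "finite I" and zero: "(\<lambda>i. 0) \<in> K"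
    and add: "\<And>f g. f \<in> K \<Longrightarrow> g \<in> K \<Longrightarrow> (\<lambda>i. f i + g i) \<in> K"
    and scale: "\<And>r f. f \<in> K \<Longrightarrow> (\<lambda>i. r *\<^sub>R f i) \<in> K"
  obtains z k where "\<And>n. k n \<in> K" "\<And>i. i \<in> I \<Longrightarrow> (\<lambda>n::nat. k n i) \<longlonglongrightarrow> z i"
    and "\<And>f. f \<in> K \<Longrightarrow> (\<Sum>i\<in>I. inner (y i - z i) (f i)) = 0"
proof -
  define N where "N f = (\<Sum>i\<in>I. (norm (f i))\<^sup>2)" for f :: "'i \<Rightarrow> 'a"
  define d where "d = (INF f\<in>K. N (\<lambda>i. y i - f i))"
  have bdd: "bdd_below ((\<lambda>f. N (\<lambda>i. y i - f i)) ` K)"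
    by (rule bdd_belowI2[of _ 0]) (simp add: N_def sum_nonneg)
  have d_le: "d \<le> N (\<lambda>i. y i - f i)" if "f \<in> K" for f
    unfolding d_def by (rule cINF_lower[OF bdd that])
  have "\<exists>f\<in>K. N (\<lambda>i. y i - f i) < d + 1 / real (Suc n)" for n
  proof -
    have "d < d + 1 / real (Suc n)" by simp
    then show ?thesis
      unfolding d_def using cINF_less_iff[OF _ bdd] zero by blast
  qed
  then obtain k where k: "\<And>n. k n \<in> K" "\<And>n. N (\<lambda>i. y i - k n i) < d + 1 / real (Suc n)"
    by metis
  \<comment> \<open>Parallelogram law. The midpoint of two near-minimisers lies in \<open>K\<close>
    and so cannot beat \<open>d\<close>, which forces the minimisers together.\<close>
  have par: "(norm (a - b))\<^sup>2 = 2 * (norm (u - a))\<^sup>2 + 2 * (norm (u - b))\<^sup>2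
      - 4 * (norm (u - (1/2) *\<^sub>R (a + b)))\<^sup>2" for a b u :: 'a
    by (simp add: power2_norm_eq_inner algebra_simps inner_commute)
  have close: "N (\<lambda>i. k m i - k n i) \<le> 2 / real (Suc m) + 2 / real (Suc n)" for m n
  proof -
    have "N (\<lambda>i. k m i - k n i) = 2 * N (\<lambda>i. y i - k m i) + 2 * N (\<lambda>i. y i - k n i)
        - 4 * N (\<lambda>i. y i - (1/2) *\<^sub>R (k m i + k n i))"
      unfolding N_def sum_distrib_left sum.distrib[symmetric] sum_subtractf[symmetric]
      by (rule sum.cong[OF refl par])
    moreover have "d \<le> N (\<lambda>i. y i - (1/2) *\<^sub>R (k m i + k n i))"
      by (intro d_le scale add k)
    ultimately show ?thesis
      using k(2)[of m] k(2)[of n] by simp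
  qed
  have "Cauchy (\<lambda>n. k n i)" if "i \<in> I" for i
  proof (rule metric_CauchyI)
    fix e :: real assume e: "e > 0"
    obtain M where M: "4 / e\<^sup>2 < real M" using reals_Archimedean2 by blast
    have "dist (k m i) (k n i) < e" if "m \<ge> M" "n \<ge> M" for m n
    proof -
      have "(norm (k m i - k n i))\<^sup>2 \<le> N (\<lambda>i. k m i - k n i)"
        unfolding N_def using \<open>i \<in> I\<close> \<open>finite I\<close>
        by (intro member_le_sum[where f = "\<lambda>i. (norm (k m i - k n i))\<^sup>2"]) auto
      also have "\<dots> \<le> 2 / real (Suc m) + 2 / real (Suc n)" by (rule close)
      also have "\<dots> \<le> 2 / real (Suc M) + 2 / real (Suc M)"
        using that by (intro add_mono divide_left_mono) auto
      also have "\<dots> < e\<^sup>2"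
      proof -
        have "4 < e\<^sup>2 * real M" using M e by (simp add: field_simps)
        also have "\<dots> \<le> e\<^sup>2 * real (Suc M)" by (intro mult_left_mono) auto
        finally have "4 / real (Suc M) < e\<^sup>2" by (subst pos_divide_less_eq) auto
        then show ?thesis by simp
      qed
      finally show ?thesis
        using e by (simp add: dist_norm power2_less_imp_less)
    qed
    then show "\<exists>M. \<forall>m\<ge>M. \<forall>n\<ge>M. dist (k m i) (k n i) < e" by blast
  qed
  then have "\<exists>z. \<forall>i\<in>I. (\<lambda>n. k n i) \<longlonglongrightarrow> z i"
    by (auto simp: Cauchy_convergent_iff convergent_def intro: bchoice)
  then obtain z where z: "\<And>i. i \<in> I \<Longrightarrow> (\<lambda>n. k n i) \<longlonglongrightarrow> z i" by blast
  \<comment> \<open>\<open>z\<close> is only a limit of members of \<open>K\<close>, so both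
    comparisons with \<open>d\<close> are obtained as limits. Perturbing \<open>z\<close> by
    \<open>t *\<^sub>R f\<close> gives a quadratic inequality in \<open>t\<close>.\<close>
  have "(\<Sum>i\<in>I. inner (y i - z i) (f i)) = 0" if f: "f \<in> K" for f
  proof (rule eq_0_if_linear_le_quadratic)
    fix t :: real
    have "(\<lambda>n. N (\<lambda>i. y i - k n i)) \<longlonglongrightarrow> N (\<lambda>i. y i - z i)"
      unfolding N_def by (intro tendsto_intros z)
    moreover have "(\<lambda>n. d + 1 / real (Suc n)) \<longlonglongrightarrow> d + 0"
      by (intro tendsto_add tendsto_const LIMSEQ_Suc[OF lim_1_over_n])
    ultimately have upper: "N (\<lambda>i. y i - z i) \<le> d + 0"
      by (rule LIMSEQ_le) (use k(2) in \<open>auto intro: less_imp_le\<close>)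
    have "(\<lambda>n. N (\<lambda>i. y i - (k n i + t *\<^sub>R f i))) \<longlonglongrightarrow> N (\<lambda>i. y i - (z i + t *\<^sub>R f i))"
      unfolding N_def by (intro tendsto_intros z)
    then have lower: "d \<le> N (\<lambda>i. y i - (z i + t *\<^sub>R f i))"
      by (rule LIMSEQ_le_const) (use d_le[OF add[OF k(1) scale[OF f]]] in blast)
    have "N (\<lambda>i. y i - (z i + t *\<^sub>R f i)) =
        N (\<lambda>i. y i - z i) - 2 * t * (\<Sum>i\<in>I. inner (y i - z i) (f i)) + t\<^sup>2 * N f"
      unfolding N_def sum_distrib_left sum.distrib[symmetric] sum_subtractf[symmetric]
        power2_norm_eq_inner
      by (rule sum.cong[OF refl]) (simp add: algebra_simps inner_commute power2_eq_square)
    then show "2 * t * (\<Sum>i\<in>I. inner (y i - z i) (f i)) \<le> t\<^sup>2 * N f"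
      using upper lower by linarith
  qed
  with k(1) z show ?thesis using that by blast
qed

text \<open>Least squares over a one-point index set; closedness of \<open>M\<close> keeps the limit
  in \<open>M\<close>.\<close>

lemma orthogonal_decomposition:
  fixes M :: "'a::{real_inner,banach} set"
  assumes "closed M" "subspace M"
  obtains z where "z \<in> M" "\<And>m. m \<in> M \<Longrightarrow> inner (y - z) m = 0"
proof -
  define K :: "(unit \<Rightarrow> 'a) set" where "K = {f. f () \<in> M}"
  obtain z k where k: "\<And>n. k n \<in> K" and z: "\<And>i. i \<in> {()} \<Longrightarrow> (\<lambda>n. k n i) \<longlonglongrightarrow> z i"
    and orth: "\<And>f. f \<in> K \<Longrightarrow> (\<Sum>i\<in>{()}. inner (y - z i) (f i)) = 0"
    by (rule least_squares_approximation[of "{()}" K "\<lambda>_. y"])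
      (use assms(2) in \<open>auto simp: K_def subspace_0 subspace_add subspace_scale\<close>)
  have "z () \<in> M"
    using k by (intro closed_sequentially[OF \<open>closed M\<close> _ z]) (auto simp: K_def)
  moreover have "inner (y - z ()) m = 0" if "m \<in> M" for m
    using orth[of "\<lambda>_. m"] that by (simp add: K_def)
  ultimately show ?thesis using that by blast
qed

text \<open>For \<open>f\<close> not identically zero, take \<open>w\<close> nonzero and orthogonal
  to the kernel of \<open>f\<close>. Every \<open>x\<close> is a multiple of \<open>w\<close> plus a
  kernel element, so a rescaling of \<open>w\<close> represents \<open>f\<close>.\<close>

lemma riesz_representation:
  fixes f :: "'a::{real_inner,banach} \<Rightarrow> real"
  assumes "bounded_linear f"
  obtains w where "\<And>x. f x = inner x w"
proof (cases "\<forall>x. f x = 0")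
  case True
  then show ?thesis using that[of 0] by simp
next
  case False
  interpret bounded_linear f by (rule assms)
  obtain y where y: "f y \<noteq> 0" using False by blast
  have "closed {x. f x = 0}"
    by (intro closed_Collect_eq continuous_on continuous_on_const continuous_on_id)
  moreover have "subspace {x. f x = 0}"
    by (auto simp: subspace_def zero add scaleR)
  ultimately obtain z where z: "f z = 0" "\<And>m. f m = 0 \<Longrightarrow> inner (y - z) m = 0"
    using orthogonal_decomposition[of "{x. f x = 0}" y] by auto
  define w where "w = y - z"
  have fw: "f w \<noteq> 0" using y z by (simp add: w_def diff)
  then have w0: "inner w w \<noteq> 0" using zero by auto
  have "f x = inner x ((f w / inner w w) *\<^sub>R w)" for x
  proof -
    have "inner w (x - (f x / f w) *\<^sub>R w) = 0"
      unfolding w_def using fw by (intro z(2)) (simp add: diff scaleR w_def)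
    then show ?thesis
      using fw w0 by (simp add: inner_diff_right field_simps inner_commute)
  qed
  then show ?thesis using that by blast
qed

section \<open>Orthogonal projections onto closed complex subspaces\<close>

lemma subspace_if_complex_subspace: "complex_vector.subspace M \<Longrightarrow> subspace M"
  by (auto simp: complex_vector.subspace_def subspace_def scaleC_complex_of_real[symmetric])

text \<open>Real orthogonality suffices: on a complex subspace, testing against
  \<open>\<i> *\<^sub>C m\<close> as well gives complex orthogonality.\<close>

definition orth_proj :: "'a::complex_inner set \<Rightarrow> 'a \<Rightarrow> 'a" where
  "orth_proj M y = (THE z. z \<in> M \<and> (\<forall>m\<in>M. inner (y - z) m = 0))"

text \<open>Two candidates differ by a vector of \<open>M\<close> that is orthogonal to
  itself.\<close>

lemma orth_proj_eqI:
  assumes "complex_vector.subspace M" "z \<in> M" "\<And>m. m \<in> M \<Longrightarrow> inner (y - z) m = 0"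
  shows "orth_proj M y = z"
  unfolding orth_proj_def
proof (rule the_equality)
  fix w assume w: "w \<in> M \<and> (\<forall>m\<in>M. inner (y - w) m = 0)"
  then have "w - z \<in> M"
    using assms(1,2) complex_vector.subspace_diff by blast
  then have "inner (y - z) (w - z) = 0" "inner (y - w) (w - z) = 0"
    using assms(3) w by auto
  then have "inner (w - z) (w - z) = 0"
    by (simp add: inner_diff_left)
  then show "w = z" by simp
qed (use assms in auto)

lemma orth_proj:
  fixes M :: "'a::complex_hilbert_space set"
  assumes "closed M" "complex_vector.subspace M"
  shows orth_proj_in: "orth_proj M y \<in> M"
    and orth_proj_orth: "m \<in> M \<Longrightarrow> inner (y - orth_proj M y) m = 0"
proof -
  obtain z where z: "z \<in> M" "\<And>m. m \<in> M \<Longrightarrow> inner (y - z) m = 0"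
    by (rule orthogonal_decomposition[OF assms(1) subspace_if_complex_subspace[OF assms(2)]]) blast
  with orth_proj_eqI[OF assms(2)] have "orth_proj M y = z" by blast
  with z show "orth_proj M y \<in> M" "m \<in> M \<Longrightarrow> inner (y - orth_proj M y) m = 0" by auto
qed

lemma orth_proj_fixes:
  "complex_vector.subspace M \<Longrightarrow> m \<in> M \<Longrightarrow> orth_proj M m = m"
  by (rule orth_proj_eqI) auto

text \<open>Linearity comes from uniqueness of the orthogonal decomposition, contractivity from
  Pythagoras.\<close>

lemma orth_proj_ops:
  fixes M :: "'a::complex_hilbert_space set"
  assumes M: "closed M" "complex_vector.subspace M"
  shows "orth_proj M \<in> \<B>"
proof (rule bounded_opsI[where K = 1])
  note P = orth_proj_in[OF M] orth_proj_orth[OF M]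
  show "orth_proj M (x + y) = orth_proj M x + orth_proj M y" for x y
  proof (rule orth_proj_eqI[OF M(2)])
    show "inner (x + y - (orth_proj M x + orth_proj M y)) m = 0" if "m \<in> M" for m
      using P(2)[OF that, of x] P(2)[OF that, of y] by (simp add: algebra_simps)
  qed (simp add: P M complex_vector.subspace_add)
  show "orth_proj M (c *\<^sub>C x) = c *\<^sub>C orth_proj M x" for c x
  proof (rule orth_proj_eqI[OF M(2)])
    show "inner (c *\<^sub>C x - c *\<^sub>C orth_proj M x) m = 0" if "m \<in> M" for m
      using P(2)[of "cnj c *\<^sub>C m" x] that M(2)
      by (simp add: scaleC_diff_right[symmetric] inner_scaleC_left complex_vector.subspace_scale)
  qed (simp add: P M complex_vector.subspace_scale)
  show "norm (orth_proj M x) \<le> norm x * 1" for x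
  proof (rule power2_le_imp_le)
    have "inner (x - orth_proj M x) (orth_proj M x) = 0" by (intro P)
    then have "(norm x)\<^sup>2 = (norm (x - orth_proj M x))\<^sup>2 + (norm (orth_proj M x))\<^sup>2"
      by (simp add: power2_norm_eq_inner algebra_simps inner_commute)
    then show "(norm (orth_proj M x))\<^sup>2 \<le> (norm x * 1)\<^sup>2" by simp
  qed simp
qed

lemma orth_proj_sym:
  fixes M :: "'a::complex_hilbert_space set"
  assumes M: "closed M" "complex_vector.subspace M"
  shows "inner (orth_proj M x) y = inner x (orth_proj M y)"
proof -
  have "inner (y - orth_proj M y) (orth_proj M x) = 0" "inner (x - orth_proj M x) (orth_proj M y) = 0"
    by (intro orth_proj_orth orth_proj_in M)+
  then show ?thesis
    by (simp add: inner_diff_left inner_commute[of y] inner_commute[of "orth_proj M y" "orth_proj M x"])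
qed

section \<open>Adjoints and reducing subspaces\<close>

lemma inner_eq_imp_eq: "(\<And>x. inner x a = inner x b) \<Longrightarrow> a = b"
  using vector_eq_ldot by blast

text \<open>The real identity suffices, since evaluating it at \<open>\<i> *\<^sub>C x\<close>
  recovers the imaginary part of \<open>cinner\<close>.\<close>

lemma adj_eqI:
  assumes "A \<in> \<B>" "B \<in> \<B>" "\<And>x y. inner (A x) y = inner x (B y)"
  shows "adj A = B"
  unfolding adj_def
proof (rule the_equality)
  have "cinner (A x) y = cinner x (B y)" for x y
    using assms(3)[of x y] assms(3)[of "\<i> *\<^sub>C x" y]
    by (simp add: cinner_conv_inner ops_scaleC[OF assms(1)])
  with assms show "B \<in> \<B> \<and> (\<forall>x y. cinner (A x) y = cinner x (B y))" by simp
next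
  fix C assume "C \<in> \<B> \<and> (\<forall>x y. cinner (A x) y = cinner x (C y))"
  then have "inner x (C y) = inner x (B y)" for x y
    by (metis Re_cinner assms(3))
  then show "C = B" by (rule ext[OF inner_eq_imp_eq])
qed

text \<open>Riesz representation supplies a vector \<open>B y\<close> for each \<open>y\<close>.
  Boundedness of \<open>B\<close> follows by applying Cauchy-Schwarz to
  \<open>inner (A (B y)) y\<close>, the squared norm of \<open>B y\<close>.\<close>

lemma
  fixes A :: "'a::complex_hilbert_space \<Rightarrow> 'a"
  assumes A: "A \<in> \<B>"
  shows adj_ops: "adj A \<in> \<B>" and inner_adj: "inner (A x) y = inner x (adj A y)"
proof -
  have "\<exists>w. \<forall>x. inner (A x) y = inner x w" for y
  proof -
    have "bounded_linear (\<lambda>x. inner (A x) y)"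
      by (rule bounded_linear_compose[OF bounded_linear_inner_left ops_bounded_linear[OF A]])
    then obtain w where "\<And>x. inner (A x) y = inner x w"
      by (rule riesz_representation) blast
    then show ?thesis by blast
  qed
  then have "\<exists>B. \<forall>y x. inner (A x) y = inner x (B y)" by (intro choice) blast
  then obtain B where B: "\<And>x y. inner (A x) y = inner x (B y)" by blast
  obtain K where K: "K > 0" "\<And>x. norm (A x) \<le> norm x * K" using ops_norm_le[OF A] by blast
  have "B \<in> \<B>"
  proof (rule bounded_opsI[where K = K])
    show "B (x + y) = B x + B y" for x y
      by (rule inner_eq_imp_eq) (simp add: B[symmetric] inner_add_right)
    show "B (c *\<^sub>C y) = c *\<^sub>C B y" for c y
    proof (rule inner_eq_imp_eq)
      fix x
      have "inner x (B (c *\<^sub>C y)) = inner (A (cnj c *\<^sub>C x)) y"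
        by (simp add: B[symmetric] ops_scaleC[OF A] inner_scaleC_left)
      then show "inner x (B (c *\<^sub>C y)) = inner x (c *\<^sub>C B y)"
        by (simp add: B inner_scaleC_left)
    qed
    show "norm (B y) \<le> norm y * K" for y
    proof (cases "B y = 0")
      case False
      have "norm (B y) * norm (B y) = inner (A (B y)) y"
        by (simp add: B norm_eq_sqrt_inner)
      also have "\<dots> \<le> norm (A (B y)) * norm y" by (rule norm_cauchy_schwarz)
      also have "\<dots> \<le> (norm (B y) * K) * norm y" by (intro mult_right_mono K) simp
      finally show ?thesis using False by (simp add: ac_simps)
    qed (use K in simp)
  qed
  with adj_eqI[OF A] B have "adj A = B" by blast
  then show "adj A \<in> \<B>" "inner (A x) y = inner x (adj A y)"
    using \<open>B \<in> \<B>\<close> B by auto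
qed

lemma adj_adj: "A \<in> \<B> \<Longrightarrow> adj (adj A) = A"
  by (rule adj_eqI) (metis adj_ops inner_adj inner_commute)+

text \<open>Invariance under the adjoint says that \<open>A\<close> maps the orthogonal complement
  of \<open>M\<close> into itself, so \<open>A\<close> respects the decomposition. Conversely,
  symmetry of the projection transfers commutation to the adjoint.\<close>

lemma reducing_iff_commutes:
  fixes M :: "'a::complex_hilbert_space set"
  assumes A: "A \<in> \<B>" and M: "closed M" "complex_vector.subspace M"
  shows "M \<in> reducing_subspaces A \<longleftrightarrow> (\<forall>x. A (orth_proj M x) = orth_proj M (A x))"
proof
  assume "M \<in> reducing_subspaces A"
  then have inv: "\<And>m. m \<in> M \<Longrightarrow> A m \<in> M" "\<And>m. m \<in> M \<Longrightarrow> adj A m \<in> M"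
    by (auto simp: reducing_subspaces_def)
  have "orth_proj M (A x) = A (orth_proj M x)" for x
  proof (rule orth_proj_eqI[OF M(2)])
    show "inner (A x - A (orth_proj M x)) m = 0" if "m \<in> M" for m
      using orth_proj_orth[OF M inv(2)[OF that]]
      by (simp add: ops_simps(3)[OF A, symmetric] inner_adj[OF A])
  qed (intro inv orth_proj_in M)
  then show "\<forall>x. A (orth_proj M x) = orth_proj M (A x)" by simp
next
  assume comm: "\<forall>x. A (orth_proj M x) = orth_proj M (A x)"
  have "A m \<in> M" if "m \<in> M" for m
    using comm orth_proj_in[OF M] orth_proj_fixes[OF M(2) that] by metis
  moreover have "adj A m \<in> M" if "m \<in> M" for m
  proof -
    have "adj A m = orth_proj M (adj A m)"
      by (rule inner_eq_imp_eq)
        (metis inner_adj[OF A] orth_proj_sym[OF M] comm orth_proj_fixes[OF M(2) that])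
    then show ?thesis using orth_proj_in[OF M] by metis
  qed
  ultimately show "M \<in> reducing_subspaces A"
    using M by (auto simp: reducing_subspaces_def)
qed

section \<open>Positive square roots\<close>

text \<open>Over the complex numbers a real-valued quadratic form forces symmetry; conversely,
  symmetry makes the imaginary part of \<open>cinner (A x) x\<close> vanish.\<close>

lemma positive_op_iff:
  "positive_op A \<longleftrightarrow> A \<in> \<B> \<and> (\<forall>x y. inner (A x) y = inner x (A y)) \<and> (\<forall>x. 0 \<le> inner (A x) x)"
proof (intro iffI conjI allI)
  assume pos: "positive_op A"
  then show A: "A \<in> \<B>" by (simp add: positive_op_def)
  have q: "inner (\<i> *\<^sub>C A x) x = 0" "0 \<le> inner (A x) x" for x
    using pos by (auto simp: positive_op_def cinner_conv_inner complex_nonneg_Reals_iff)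
  show "0 \<le> inner (A x) x" for x by (rule q)
  \<comment> \<open>Polarisation of the vanishing imaginary part; substituting
    \<open>\<i> *\<^sub>C x\<close> for \<open>x\<close> below turns it into symmetry.\<close>
  have polar: "inner (\<i> *\<^sub>C A x) y = - inner (\<i> *\<^sub>C A y) x" for x y
    using q(1)[of "x + y"] q(1)[of x] q(1)[of y]
    by (simp add: ops_simps(2)[OF A] scaleC_add_right inner_add_left inner_add_right)
  show "inner (A x) y = inner x (A y)" for x y
    using polar[of "\<i> *\<^sub>C x" y]
    by (simp add: ops_scaleC[OF A] scaleC_scaleC scaleC_uminus_left scaleC_one
        inner_imaginary_left scaleC_uminus_right inner_commute)
next
  assume "A \<in> \<B> \<and> (\<forall>x y. inner (A x) y = inner x (A y)) \<and> (\<forall>x. 0 \<le> inner (A x) x)"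
  then have A: "A \<in> \<B>" and sym: "\<And>x y. inner (A x) y = inner x (A y)"
    and pos: "\<And>x. 0 \<le> inner (A x) x" by blast+
  have "inner (\<i> *\<^sub>C A x) x = - inner (\<i> *\<^sub>C A x) x" for x
    using sym[of "\<i> *\<^sub>C x" x]
    by (simp add: ops_scaleC[OF A] inner_imaginary_left[of x] inner_commute[of x])
  then show "positive_op A"
    using A pos by (simp add: positive_op_def cinner_conv_inner complex_nonneg_Reals_iff)
qed

lemma positive_opD:
  assumes "positive_op A"
  shows "A \<in> \<B>" "inner (A x) y = inner x (A y)" "0 \<le> inner (A x) x"
  using assms by (auto simp: positive_op_iff)

text \<open>The degenerate case of Cauchy-Schwarz for the form of \<open>A\<close>: positivity at
  \<open>x - t *\<^sub>R y\<close> leaves only a linear and a quadratic term in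
  \<open>t\<close>.\<close>

lemma positive_op_null:
  assumes "positive_op A" "inner (A x) x = 0"
  shows "A x = 0"
proof -
  note A = positive_opD[OF assms(1)]
  have "inner (A x) y = 0" for y
  proof (rule eq_0_if_linear_le_quadratic)
    fix t :: real
    have "0 \<le> inner (A (x - t *\<^sub>R y)) (x - t *\<^sub>R y)" by (rule A)
    also have "\<dots> = - 2 * t * inner (A x) y + t\<^sup>2 * inner (A y) y"
      by (simp add: ops_simps[OF A(1)] inner_diff_left inner_diff_right assms(2) A(2)[of y x]
          inner_commute[of y] power2_eq_square algebra_simps)
    finally show "2 * t * inner (A x) y \<le> t\<^sup>2 * inner (A y) y" by simp
  qed
  then show ?thesis using inner_eq_zero_iff by blast
qed

text \<open>Positivity at \<open>x - A x\<close> reads \<open>0 \<le> A - 2A^2 + A^3\<close>, and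
  \<open>A \<le> 1\<close> gives \<open>A^3 \<le> A^2\<close>; hence
  \<open>A^2 \<le> A \<le> 1\<close>.\<close>

lemma norm_le_if_le_identity:
  assumes "positive_op A" "\<And>x. inner (A x) x \<le> inner x x"
  shows "norm (A x) \<le> norm x"
proof (rule power2_le_imp_le)
  note A = positive_opD[OF assms(1)]
  have "0 \<le> inner (A (x - A x)) (x - A x)" by (rule A)
  also have "\<dots> = inner (A x) x - 2 * inner (A x) (A x) + inner (A (A x)) (A x)"
    by (simp add: ops_simps[OF A(1)] inner_diff_left inner_diff_right A(2)[of "A x" x])
  also have "\<dots> \<le> inner (A x) x - inner (A x) (A x)"
    using assms(2)[of "A x"] by simp
  finally show "(norm (A x))\<^sup>2 \<le> (norm x)\<^sup>2"
    using assms(2)[of x] by (simp add: power2_norm_eq_inner)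
qed simp

text \<open>The iteration \<open>X\<^sub>n\<^sub>+\<^sub>1 = (A + X\<^sub>n\<^sup>2) / 2\<close> is dominated by the scalar iteration for \<open>A = 1\<close>,
  which increases to \<open>1\<close>. Its limit \<open>L\<close> satisfies \<open>(1 - L)\<^sup>2 = 1 - A\<close>.\<close>

lemma quadratic_fixed_point:
  fixes A :: "'a::complex_hilbert_space \<Rightarrow> 'a"
  assumes A: "A \<in> \<B>" and sym: "\<And>x y. inner (A x) y = inner x (A y)"
    and contr: "\<And>x. norm (A x) \<le> norm x"
  obtains L where "L \<in> \<B>" "\<And>x y. inner (L x) y = inner x (L y)" "\<And>x. norm (L x) \<le> norm x"
    "\<And>x. A x = 2 *\<^sub>R L x - L (L x)"
    "\<And>B x. B \<in> \<B> \<Longrightarrow> (\<And>x. B (A x) = A (B x)) \<Longrightarrow> B (L x) = L (B x)"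
proof -
  define s :: "nat \<Rightarrow> real" where "s = rec_nat 0 (\<lambda>_ r. (1 + r\<^sup>2) / 2)"
  define X where "X = rec_nat (\<lambda>v. 0) (\<lambda>_ Y v. (1/2) *\<^sub>R (A v + Y (Y v)))"
  have s0: "s 0 = 0" and sS: "\<And>n. s (Suc n) = (1 + (s n)\<^sup>2) / 2"
    by (simp_all add: s_def)
  have X0: "X 0 = (\<lambda>v. 0)" and XS: "\<And>n. X (Suc n) = (\<lambda>v. (1/2) *\<^sub>R (A v + X n (X n v)))"
    by (simp_all add: X_def)
  have s01: "0 \<le> s n \<and> s n \<le> 1" for n
    by (induction n) (auto simp: s0 sS power_le_one)
  have "s n \<le> s (Suc n)" for n
    using zero_le_power2[of "1 - s n"] by (simp add: sS power2_eq_square algebra_simps)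
  then have s_mono: "incseq s" by (rule incseq_SucI)
  have "convergent s"
    using s01 by (intro Bseq_mono_convergent BseqI'[of _ 1]) (auto intro: incseqD[OF s_mono])
  then have s_Cauchy: "Cauchy s" by (rule convergent_Cauchy)
  have X_ops: "X n \<in> \<B>" for n
  proof (induction n)
    case 0 then show ?case
      by (simp add: X0 bounded_opsI[where K = 0])
  next
    case (Suc n) then show ?case
      unfolding XS by (intro ops_multR[OF ops_plus[OF A ops_comp]])
  qed
  note X_simps = ops_simps[OF X_ops]
  have X_comm: "B (X n v) = X n (B v)" if "B \<in> \<B>" "\<And>x. B (A x) = A (B x)" for B n v
    by (induction n arbitrary: v) (simp_all add: X0 XS that(2) ops_simps[OF that(1)])
  \<comment> \<open>The iterates commute with one another: \<open>X_comm\<close> is used with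
    \<open>B = A\<close> first, and then with \<open>B = X m\<close>.\<close>
  have X_A: "X n (A v) = A (X n v)" for n v by (rule X_comm[OF A, symmetric]) simp
  have X_X: "X m (X n v) = X n (X m v)" for m n v by (rule X_comm[OF X_ops X_A])
  have X_norm: "norm (X n v) \<le> norm v * s n" for n v
  proof (induction n arbitrary: v)
    case (Suc n)
    have "norm (A v + X n (X n v)) \<le> norm v + norm (X n v) * s n"
      by (intro norm_triangle_le add_mono contr Suc)
    also have "\<dots> \<le> norm v + (norm v * s n) * s n"
      using s01 by (intro add_left_mono mult_right_mono Suc) auto
    finally have "norm (A v + X n (X n v)) \<le> norm v * (1 + (s n)\<^sup>2)"
      by (simp add: power2_eq_square algebra_simps)
    then show ?case by (simp add: XS sS del: scaleR_add_right)
  qed (simp add: X0 s0)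
  \<comment> \<open>Commutation factors the difference of squares, so successive differences of
    \<open>X\<close> obey the same recursion as those of \<open>s\<close> and are dominated by
    them.\<close>
  have X_step: "norm (X (Suc n) v - X n v) \<le> norm v * (s (Suc n) - s n)" for n v
  proof (induction n arbitrary: v)
    case 0 then show ?case using contr by (simp add: X0 XS s0 sS A)
  next
    case (Suc n)
    define w where "w = X (Suc n) v - X n v"
    have "X (Suc (Suc n)) v - X (Suc n) v = (1/2) *\<^sub>R (X (Suc n) (X (Suc n) v) - X n (X n v))"
      using fun_cong[OF XS[of "Suc n"], of v] fun_cong[OF XS[of n], of v]
      by (metis add_diff_cancel_left scaleR_diff_right)
    also have "X (Suc n) (X (Suc n) v) - X n (X n v) = X (Suc n) w + X n w"
      by (simp add: w_def X_simps X_X[of n "Suc n"])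
    finally have "norm (X (Suc (Suc n)) v - X (Suc n) v) = norm (X (Suc n) w + X n w) / 2"
      by simp
    also have "\<dots> \<le> (norm w * s (Suc n) + norm w * s n) / 2"
      by (intro divide_right_mono norm_triangle_le add_mono X_norm) simp
    also have "\<dots> = norm w * ((s (Suc n) + s n) / 2)" by (simp add: algebra_simps)
    also have "\<dots> \<le> norm v * (s (Suc n) - s n) * ((s (Suc n) + s n) / 2)"
      unfolding w_def using s01[of n] s01[of "Suc n"] by (intro mult_right_mono Suc) auto
    also have "\<dots> = norm v * (s (Suc (Suc n)) - s (Suc n))"
      by (simp add: sS[of "Suc n"]) (simp add: sS power2_eq_square field_simps)
    finally show ?case .
  qed
  have X_diff: "norm (X (n + k) v - X n v) \<le> norm v * (s (n + k) - s n)" for n k v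
  proof (induction k)
    case (Suc k)
    have "norm (X (n + Suc k) v - X n v) \<le>
        norm (X (Suc (n + k)) v - X (n + k) v) + norm (X (n + k) v - X n v)"
      using norm_triangle_ineq[of "X (Suc (n + k)) v - X (n + k) v" "X (n + k) v - X n v"] by simp
    also have "\<dots> \<le> norm v * (s (Suc (n + k)) - s (n + k)) + norm v * (s (n + k) - s n)"
      by (intro add_mono X_step Suc)
    finally show ?case by (simp add: algebra_simps)
  qed simp
  have "Cauchy (\<lambda>n. X n v)" for v
  proof (rule CauchyI')
    fix e :: real assume e: "e > 0"
    then have "e / (norm v + 1) > 0" by (simp add: add_nonneg_pos)
    from CauchyD[OF s_Cauchy this] obtain M
      where M: "\<And>m n. m \<ge> M \<Longrightarrow> n \<ge> M \<Longrightarrow> norm (s m - s n) < e / (norm v + 1)" by blast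
    have "dist (X m v) (X n v) < e" if "m \<ge> M" "m < n" for m n
    proof -
      have "norm (X n v - X m v) \<le> norm v * (s n - s m)"
        using X_diff[of m "n - m" v] that by simp
      also have "\<dots> \<le> norm v * (e / (norm v + 1))"
        using M[of n m] that by (intro mult_left_mono) auto
      also have "\<dots> < e"
        using e by (simp add: pos_divide_less_eq add_nonneg_pos)
      finally show ?thesis by (simp add: dist_norm norm_minus_commute)
    qed
    then show "\<exists>M. \<forall>m\<ge>M. \<forall>n>m. dist (X m v) (X n v) < e" by blast
  qed
  then have "\<exists>L. \<forall>v. (\<lambda>n. X n v) \<longlonglongrightarrow> L v"
    by (intro choice) (auto simp: Cauchy_convergent_iff convergent_def)
  then obtain L where L: "\<And>v. (\<lambda>n. X n v) \<longlonglongrightarrow> L v" by blast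
  have X_contr: "norm (X n v) \<le> norm v" for n v
    using X_norm[of n v] s01[of n] mult_left_le[of "s n" "norm v"] by simp
  have L_contr: "norm (L v) \<le> norm v" for v
    by (rule LIMSEQ_le_const2[OF tendsto_norm[OF L]]) (use X_contr in blast)
  have L_ops: "L \<in> \<B>"
  proof (rule bounded_opsI[where K = 1])
    show "L (x + y) = L x + L y" for x y
      using tendsto_add[OF L L, of x y] L[of "x + y"] by (simp add: X_simps LIMSEQ_unique)
    show "L (c *\<^sub>C x) = c *\<^sub>C L x" for c x
      using bounded_linear.tendsto[OF bounded_linear_scaleC L, of c x] L[of "c *\<^sub>C x"]
      by (simp add: ops_scaleC[OF X_ops] LIMSEQ_unique)
  qed (simp add: L_contr)
  have X_sym: "inner (X n x) y = inner x (X n y)" for n x y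
    by (induction n arbitrary: x y)
      (simp_all add: X0 XS inner_add_left inner_add_right sym)
  have L_sym: "inner (L x) y = inner x (L y)" for x y
    using tendsto_inner[OF L tendsto_const, of x y] tendsto_inner[OF tendsto_const L, of x y]
    unfolding X_sym by (rule LIMSEQ_unique)
  \<comment> \<open>Split \<open>X n (X n v)\<close> as
    \<open>X n (X n v - L v) + X n (L v)\<close>; the first term vanishes in the limit because every
    \<open>X n\<close> is a contraction.\<close>
  have XX: "(\<lambda>n. X n (X n v)) \<longlonglongrightarrow> L (L v)" for v
  proof -
    have "(\<lambda>n. X n (X n v - L v)) \<longlonglongrightarrow> 0"
      by (rule Lim_null_comparison[of _ "\<lambda>n. norm (X n v - L v)"])
        (use X_contr tendsto_norm_zero[OF LIM_zero[OF L]] in auto)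
    from tendsto_add[OF this L[of "L v"]] show ?thesis by (simp add: X_simps)
  qed
  have "L v = (1/2) *\<^sub>R (A v + L (L v))" for v
  proof (rule LIMSEQ_unique)
    show "(\<lambda>n. X (Suc n) v) \<longlonglongrightarrow> L v" by (rule LIMSEQ_Suc[OF L])
    show "(\<lambda>n. X (Suc n) v) \<longlonglongrightarrow> (1/2) *\<^sub>R (A v + L (L v))"
      unfolding XS by (intro tendsto_intros XX)
  qed
  then have "2 *\<^sub>R L v = 2 *\<^sub>R (1/2) *\<^sub>R (A v + L (L v))" for v by simp
  then have L_eq: "A v = 2 *\<^sub>R L v - L (L v)" for v by simp
  have "B (L v) = L (B v)" if "B \<in> \<B>" "\<And>x. B (A x) = A (B x)" for B v
    using ops_tendsto[OF that(1) L, of v] L[of "B v"] by (simp add: X_comm[OF that] LIMSEQ_unique)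
  with L_ops L_sym L_contr L_eq show ?thesis using that by blast
qed

text \<open>For a norm bound \<open>c\<close> of \<open>B\<close>, the operator
  \<open>A = 1 - B/c\<close> lies between 0 and 1. The fixed point \<open>L\<close> satisfies
  \<open>(1 - L)^2 = B/c\<close>, so \<open>sqrt c\<close> times \<open>1 - L\<close> is the root,
  positive because \<open>L\<close> is a contraction.\<close>

lemma positive_sqrt_exists:
  fixes B :: "'a::complex_hilbert_space \<Rightarrow> 'a"
  assumes "positive_op B"
  obtains R where "positive_op R" "\<And>x. R (R x) = B x"
    "\<And>X x. X \<in> \<B> \<Longrightarrow> (\<And>x. X (B x) = B (X x)) \<Longrightarrow> X (R x) = R (X x)"
proof -
  note B = positive_opD[OF assms]
  obtain c where c: "c > 0" "\<And>x. norm (B x) \<le> norm x * c" using ops_norm_le[OF B(1)] by blast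
  define A where "A = (\<lambda>x. x - (1/c) *\<^sub>R B x)"
  have A_ops: "A \<in> \<B>" unfolding A_def by (rule ops_minus[OF ops_ident ops_multR[OF B(1)]])
  have A_sym: "inner (A x) y = inner x (A y)" for x y
    by (simp add: A_def inner_diff_left inner_diff_right B(2))
  have "0 \<le> inner (A x) x" for x
  proof -
    have "inner (B x) x \<le> norm (B x) * norm x" by (rule norm_cauchy_schwarz)
    also have "\<dots> \<le> (norm x * c) * norm x" by (intro mult_right_mono c) simp
    finally show ?thesis
      using c(1) by (simp add: A_def inner_diff_left field_simps power2_norm_eq_inner[symmetric] power2_eq_square)
  qed
  then have "positive_op A" by (simp add: positive_op_iff A_ops A_sym)
  then have A_contr: "norm (A x) \<le> norm x" for x
    by (rule norm_le_if_le_identity) (use B(3) c(1) in \<open>simp add: A_def inner_diff_left\<close>)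
  obtain L where L: "L \<in> \<B>" "\<And>x y. inner (L x) y = inner x (L y)" "\<And>x. norm (L x) \<le> norm x"
    "\<And>x. A x = 2 *\<^sub>R L x - L (L x)"
    "\<And>B x. B \<in> \<B> \<Longrightarrow> (\<And>x. B (A x) = A (B x)) \<Longrightarrow> B (L x) = L (B x)"
    by (rule quadratic_fixed_point[OF A_ops A_sym A_contr]) blast
  define R where "R = (\<lambda>x. sqrt c *\<^sub>R (x - L x))"
  have "R \<in> \<B>" unfolding R_def by (rule ops_multR[OF ops_minus[OF ops_ident L(1)]])
  moreover have "inner (R x) y = inner x (R y)" for x y
    by (simp add: R_def inner_diff_left inner_diff_right L(2))
  moreover have "0 \<le> inner (R x) x" for x
  proof -
    have "inner (L x) x \<le> norm (L x) * norm x" by (rule norm_cauchy_schwarz)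
    also have "\<dots> \<le> norm x * norm x" by (intro mult_right_mono L) simp
    finally show ?thesis
      using c(1) by (simp add: R_def inner_diff_left power2_norm_eq_inner[symmetric] power2_eq_square)
  qed
  moreover have "R (R x) = B x" for x
  proof -
    have "R (R x) = c *\<^sub>R (x - (2 *\<^sub>R L x - L (L x)))"
      using c(1) by (simp add: R_def ops_simps[OF L(1)] scaleR_2 algebra_simps)
    also have "\<dots> = B x" using c(1) by (simp add: L(4)[symmetric] A_def)
    finally show ?thesis .
  qed
  moreover have "X (R x) = R (X x)" if X: "X \<in> \<B>" and comm: "\<And>x. X (B x) = B (X x)" for X x
  proof -
    have "X (L x) = L (X x)"
      by (rule L(5)[OF X]) (simp add: A_def ops_simps[OF X] comm)
    then show ?thesis by (simp add: R_def ops_simps[OF X])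
  qed
  ultimately show ?thesis by (intro that[of R]) (auto simp: positive_op_iff)
qed

text \<open>What remains is uniqueness. Any other positive root \<open>S\<close> commutes with
  \<open>B\<close>, hence with the constructed root \<open>R\<close>, and therefore
  \<open>(R + S)(R - S) = 0\<close>.\<close>

lemma
  fixes B :: "'a::complex_hilbert_space \<Rightarrow> 'a"
  assumes "positive_op B"
  shows positive_sqrt_op: "positive_op (sqrt_op B)"
    and sqrt_op_sqrt_op: "sqrt_op B (sqrt_op B x) = B x"
    and sqrt_op_commutes:
      "X \<in> \<B> \<Longrightarrow> (\<And>x. X (B x) = B (X x)) \<Longrightarrow> X (sqrt_op B x) = sqrt_op B (X x)"
proof -
  obtain R where R: "positive_op R" "\<And>x. R (R x) = B x"
    "\<And>X x. X \<in> \<B> \<Longrightarrow> (\<And>x. X (B x) = B (X x)) \<Longrightarrow> X (R x) = R (X x)"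
    using positive_sqrt_exists[OF assms] by blast
  note R' = positive_opD[OF R(1)]
  have "sqrt_op B = R"
    unfolding sqrt_op_def
  proof (rule the_equality)
    show "positive_op R \<and> R \<circ> R = B" using R by auto
    fix S assume "positive_op S \<and> S \<circ> S = B"
    then have S: "positive_op S" "\<And>x. S (S x) = B x" by (auto simp: fun_eq_iff)
    note S' = positive_opD[OF S(1)]
    have SR: "S (R x) = R (S x)" for x
      by (rule R(3)[OF S'(1)]) (simp add: S(2)[symmetric])
    have "S x = R x" for x
    proof -
      \<comment> \<open>Since \<open>(R + S) y = 0\<close>, both positive forms vanish at
        \<open>y\<close>, so \<open>R y = S y = 0\<close>. Symmetry then turns
        \<open>inner y y\<close> into \<open>inner (R y - S y) x\<close>, which is 0.\<close>
      define y where "y = R x - S x"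
      have "R y + S y = 0"
        by (simp add: y_def ops_simps[OF R'(1)] ops_simps[OF S'(1)] R(2) S(2) SR)
      then have "inner (R y) y + inner (S y) y = 0" by (metis inner_add_left inner_zero_left)
      with R'(3)[of y] S'(3)[of y] have "inner (R y) y = 0" "inner (S y) y = 0" by linarith+
      then have "R y = 0" "S y = 0" using positive_op_null R(1) S(1) by blast+
      moreover have "inner y y = inner (R y) x - inner (S y) x"
        by (simp add: R'(2) S'(2) inner_diff_right[symmetric] y_def[symmetric])
      ultimately have "inner y y = 0" by simp
      then show ?thesis by (simp add: y_def)
    qed
    then show "S = R" by blast
  qed
  then show "positive_op (sqrt_op B)" "sqrt_op B (sqrt_op B x) = B x"
    "X \<in> \<B> \<Longrightarrow> (\<And>x. X (B x) = B (X x)) \<Longrightarrow> X (sqrt_op B x) = sqrt_op B (X x)"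
    using R by auto
qed

section \<open>Operators commuting with all reducing projections\<close>

lemma adj_eq_self:
  assumes "A \<in> \<B>" "\<And>x y. inner (A x) y = inner x (A y)"
  shows "adj A = A"
  by (rule adj_eqI[OF assms(1,1,2)])

lemma invariant_imp_reducing:
  assumes "A \<in> \<B>" "\<And>x y. inner (A x) y = inner x (A y)"
    and "closed M" "complex_vector.subspace M" "\<And>m. m \<in> M \<Longrightarrow> A m \<in> M"
  shows "M \<in> reducing_subspaces A"
  using assms by (auto simp: reducing_subspaces_def adj_eq_self)

text \<open>One step of a binary expansion: \<open>X = ((1 - Q) + X') / 2\<close>, where \<open>1 - Q\<close> is a projection
  onto a subspace on which \<open>X \<ge> 1/2\<close>, whereas \<open>X \<le> 1/2\<close> on the range \<open>ker (\<bar>Y\<bar> + Y)\<close> of \<open>Q\<close>,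
  for \<open>Y = X - 1/2\<close>.\<close>

lemma binary_digit:
  fixes S X :: "'a::complex_hilbert_space \<Rightarrow> 'a"
  assumes S: "S \<in> \<B>" and S_sym: "\<And>x y. inner (S x) y = inner x (S y)"
    and pos: "positive_op X" and le1: "\<And>x. inner (X x) x \<le> inner x x"
    and comm: "\<And>x. S (X x) = X (S x)"
  obtains M X' where "closed M" "complex_vector.subspace M" "M \<in> reducing_subspaces S"
    "positive_op X'" "\<And>x. inner (X' x) x \<le> inner x x" "\<And>x. S (X' x) = X' (S x)"
    "\<And>x. X' x = 2 *\<^sub>R X x - (x - orth_proj M x)"
proof -
  note X = positive_opD[OF pos]
  define Y where "Y = (\<lambda>x. X x - (1/2) *\<^sub>R x)"
  have Y: "Y \<in> \<B>" unfolding Y_def by (rule ops_minus[OF X(1) ops_multR[OF ops_ident]])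
  have Y_sym: "inner (Y x) y = inner x (Y y)" for x y
    by (simp add: Y_def inner_diff_left inner_diff_right X(2))
  have "0 \<le> inner (Y (Y x)) x" for x
    unfolding Y_sym[of "Y x"] by (rule inner_ge_zero)
  then have sqrt_YY: "positive_op (\<lambda>x. Y (Y x))"
    by (simp add: positive_op_iff ops_comp[OF Y Y] Y_sym)
  \<comment> \<open>\<open>D\<close> is the absolute value of \<open>Y\<close>, so \<open>M\<close>
    below is the subspace on which \<open>Y\<close> equals minus its absolute value.\<close>
  define D where "D = sqrt_op (\<lambda>x. Y (Y x))"
  note D = positive_opD[OF positive_sqrt_op[OF sqrt_YY], folded D_def]
  have DD: "D (D x) = Y (Y x)" for x
    unfolding D_def by (rule sqrt_op_sqrt_op[OF sqrt_YY])
  have YD: "Y (D x) = D (Y x)" for x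
    unfolding D_def by (rule sqrt_op_commutes[OF sqrt_YY Y]) simp
  have SY: "S (Y x) = Y (S x)" for x
    by (simp add: Y_def ops_simps[OF S] comm)
  have SD: "S (D x) = D (S x)" for x
    unfolding D_def by (rule sqrt_op_commutes[OF sqrt_YY S]) (simp add: SY)
  define M where "M = {x. D x + Y x = 0}"
  have M: "closed M" "complex_vector.subspace M"
  proof -
    have "continuous_on UNIV (\<lambda>x. D x + Y x)"
      using linear_continuous_on[OF ops_bounded_linear[OF ops_plus[OF D(1) Y]]] .
    then show "closed M" unfolding M_def by (intro closed_Collect_eq) auto
    show "complex_vector.subspace M"
      by (auto simp: M_def complex_vector.subspace_def ops_simps[OF D(1)] ops_simps[OF Y]
          ops_scaleC[OF D(1)] ops_scaleC[OF Y] scaleC_add_right[symmetric])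
        (simp add: algebra_simps add_eq_0_iff2)
  qed
  \<comment> \<open>Stated for a general \<open>A\<close> because it is applied to \<open>S\<close>,
    to \<open>Y\<close> and to \<open>D\<close>.\<close>
  have reducing: "M \<in> reducing_subspaces A"
    if A: "A \<in> \<B>" "\<And>x y. inner (A x) y = inner x (A y)"
      and comm: "\<And>x. A (D x) = D (A x)" "\<And>x. A (Y x) = Y (A x)" for A
  proof (rule invariant_imp_reducing[OF A M])
    fix m assume "m \<in> M"
    then have "A (D m + Y m) = 0" by (simp add: M_def ops_simps[OF A(1)])
    then show "A m \<in> M" by (simp add: M_def ops_simps[OF A(1)] comm)
  qed
  have S_M: "M \<in> reducing_subspaces S" by (rule reducing[OF S S_sym SD SY])
  have YQ: "Y (orth_proj M x) = orth_proj M (Y x)" for x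
    using reducing[OF Y Y_sym YD refl] reducing_iff_commutes[OF Y M] by blast
  have DQ: "D (orth_proj M x) = orth_proj M (D x)" for x
    using reducing[OF D(1,2) refl YD[symmetric]] reducing_iff_commutes[OF D(1) M] by blast
  note Q = orth_proj_ops[OF M]
  note Q_simps = ops_simps[OF Q]
  define X' where "X' = (\<lambda>x. 2 *\<^sub>R X x - (x - orth_proj M x))"
  have X'_ops: "X' \<in> \<B>"
    unfolding X'_def by (rule ops_minus[OF ops_multR[OF X(1)] ops_minus[OF ops_ident Q]])
  have X'_sym: "inner (X' x) y = inner x (X' y)" for x y
    by (simp add: X'_def inner_diff_left inner_diff_right X(2) orth_proj_sym[OF M])
  have bounds: "0 \<le> inner (X' x) x \<and> inner (X' x) x \<le> inner x x" for x
  proof -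
    define a where "a = orth_proj M x"
    define b where "b = x - a"
    have x: "x = a + b" by (simp add: b_def)
    have a: "a \<in> M" unfolding a_def by (rule orth_proj_in[OF M])
    have b: "inner b m = 0" if "m \<in> M" for m
      unfolding b_def a_def by (rule orth_proj_orth[OF M that])
    have Xa: "X a \<in> M"
    proof -
      have "Y a \<in> M" unfolding a_def YQ by (rule orth_proj_in[OF M])
      moreover have "X a = Y a + complex_of_real (1/2) *\<^sub>C a"
        unfolding scaleC_complex_of_real by (simp add: Y_def)
      ultimately show ?thesis
        using M(2) a by (simp only: complex_vector.subspace_add complex_vector.subspace_scale)
    qed
    have "D a = - Y a" using a by (simp add: M_def add_eq_0_iff2)
    then have Ya: "inner (Y a) a \<le> 0" using D(3)[of a] by simp
    \<comment> \<open>\<open>(D + Y)(D - Y) = D^2 - Y^2 = 0\<close>. The projection onto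
      \<open>M\<close> fixes this vector but commutes with \<open>D\<close> and \<open>Y\<close> and
      kills \<open>b\<close>, so the vector is zero and \<open>Y\<close> agrees with
      \<open>D\<close> at \<open>b\<close>.\<close>
    have "D b - Y b \<in> M"
      by (simp add: M_def ops_simps[OF D(1)] ops_simps[OF Y] DD YD)
    then have "D b - Y b = orth_proj M (D b - Y b)"
      by (simp add: orth_proj_fixes[OF M(2)])
    also have "\<dots> = D (orth_proj M b) - Y (orth_proj M b)" by (simp add: Q_simps DQ YQ)
    also have "orth_proj M b = 0"
      unfolding b_def by (simp add: Q_simps orth_proj_fixes[OF M(2) a]) (simp add: a_def)
    finally have "Y b = D b" by (simp add: ops_simps[OF D(1)] ops_simps[OF Y])
    then have Yb: "0 \<le> inner (Y b) b" using D(3)[of b] by simp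
    have X_split: "inner (X x) x = inner (X a) a + inner (X b) b"
      unfolding x using b[OF Xa] X(2)[of b a]
      by (simp add: ops_simps[OF X(1)] inner_add_left inner_add_right inner_commute[of "X a" b])
    have norm_split: "inner x x = inner a a + inner b b"
      unfolding x using b[OF a] by (simp add: inner_add_left inner_add_right inner_commute[of a b])
    \<comment> \<open>The form of \<open>X'\<close> is that of \<open>2X\<close> at \<open>a\<close>
      plus that of \<open>2X - 1\<close> at \<open>b\<close>. The signs of \<open>Y\<close> at
      \<open>a\<close> and \<open>b\<close>, together with \<open>0 \<le> X \<le> 1\<close>, put
      both summands between 0 and the respective squared norm.\<close>
    have "inner (X' x) x = 2 * inner (X x) x - inner b x"
      by (simp add: X'_def inner_diff_left b_def a_def)
    also have "inner b x = inner b b"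
      unfolding x using b[OF a] by (simp add: inner_add_right)
    finally have "inner (X' x) x = 2 * inner (X a) a + 2 * inner (X b) b - inner b b"
      by (simp add: X_split)
    moreover have "2 * inner (X a) a = 2 * inner (Y a) a + inner a a"
      "2 * inner (X b) b = 2 * inner (Y b) b + inner b b"
      by (simp_all add: Y_def inner_diff_left)
    ultimately show ?thesis
      using Ya Yb X(3)[of a] le1[of b] norm_split by auto
  qed
  have "S (X' x) = X' (S x)" for x
    using S_M by (simp add: X'_def ops_simps[OF S] comm reducing_iff_commutes[OF S M])
  moreover have "positive_op X'" using bounds X'_ops X'_sym by (simp add: positive_op_iff)
  ultimately show ?thesis using that M S_M bounds X'_def by blast
qed

text \<open>\<open>T\<close> commutes with the digit projections, so extracting a binary digit
  doubles the commutator with \<open>T\<close>. All these commutators share one bound, so the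
  original one is zero; no convergent series has to be formed.\<close>

lemma commutes_if_commutes_projections:
  fixes S T X :: "'a::complex_hilbert_space \<Rightarrow> 'a"
  assumes S: "S \<in> \<B>" and S_sym: "\<And>x y. inner (S x) y = inner x (S y)"
    and T: "T \<in> \<B>" and red: "reducing_subspaces S \<subseteq> reducing_subspaces T"
    and X: "X \<in> \<B>" and comm: "\<And>x. S (X x) = X (S x)"
  shows "T (X x) = X (T x)"
proof -
  obtain K where K: "K > 0" "\<And>x. norm (T x) \<le> norm x * K" using ops_norm_le[OF T] by blast
  have commutator_le: "norm (T (X v) - X (T v)) \<le> 2 * norm v * K / 2 ^ n"
    if "positive_op X" "\<And>x. inner (X x) x \<le> inner x x" "\<And>x. S (X x) = X (S x)" for X n v
    using that
  proof (induction n arbitrary: X)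
    case 0
    have "norm (T (X v) - X (T v)) \<le> norm (T (X v)) + norm (X (T v))" by (rule norm_triangle_ineq4)
    also have "\<dots> \<le> norm (X v) * K + norm (T v)"
      by (intro add_mono K norm_le_if_le_identity 0)
    also have "\<dots> \<le> norm v * K + norm v * K"
      using K(1) by (intro add_mono mult_right_mono K norm_le_if_le_identity 0) auto
    finally show ?case by (simp add: mult.commute)
  next
    case (Suc n)
    obtain M X' where M: "closed M" "complex_vector.subspace M" "M \<in> reducing_subspaces S"
      and X': "positive_op X'" "\<And>x. inner (X' x) x \<le> inner x x" "\<And>x. S (X' x) = X' (S x)"
        "\<And>x. X' x = 2 *\<^sub>R X x - (x - orth_proj M x)"
      using binary_digit[OF S S_sym Suc.prems] by blast
    have "T (orth_proj M x) = orth_proj M (T x)" for x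
      using M(3) red reducing_iff_commutes[OF T M(1,2)] by blast
    then have "T (X' v) - X' (T v) = 2 *\<^sub>R (T (X v) - X (T v))"
      by (simp add: X'(4) ops_simps[OF T] algebra_simps)
    then have "2 * norm (T (X v) - X (T v)) = norm (T (X' v) - X' (T v))" by simp
    also have "\<dots> \<le> 2 * norm v * K / 2 ^ n" by (rule Suc.IH[OF X'(1-3)])
    finally show ?case by (simp add: field_simps)
  qed
  have unit: "T (X v) = X (T v)"
    if "positive_op X" "\<And>x. inner (X x) x \<le> inner x x" "\<And>x. S (X x) = X (S x)" for X v
  proof -
    have "(\<lambda>n. 2 * norm v * K * (1/2) ^ n) \<longlonglongrightarrow> 2 * norm v * K * 0"
      by (intro tendsto_intros LIMSEQ_power_zero) simp
    moreover have "norm (T (X v) - X (T v)) \<le> 2 * norm v * K * (1/2) ^ n" for n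
      using commutator_le[OF that, of v n] by (simp add: power_one_over)
    ultimately have "norm (T (X v) - X (T v)) \<le> 2 * norm v * K * 0"
      by (intro LIMSEQ_le_const) auto
    then show ?thesis by simp
  qed
  have self_adjoint: "T (X v) = X (T v)"
    if X: "X \<in> \<B>" "\<And>x y. inner (X x) y = inner x (X y)" "\<And>x. S (X x) = X (S x)" for X v
  proof -
    obtain c where c: "c > 0" "\<And>x. norm (X x) \<le> norm x * c" using ops_norm_le[OF X(1)] by blast
    \<comment> \<open>The bound \<open>c\<close> places \<open>X\<close> between \<open>-c\<close>
      and \<open>c\<close>; this affine change moves it between 0 and 1 without affecting
      commutation.\<close>
    define Z where "Z = (\<lambda>x. (1 / (2 * c)) *\<^sub>R X x + (1/2) *\<^sub>R x)"
    have Z: "Z \<in> \<B>"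
      unfolding Z_def by (rule ops_plus[OF ops_multR[OF X(1)] ops_multR[OF ops_ident]])
    have Z_sym: "inner (Z x) y = inner x (Z y)" for x y
      by (simp add: Z_def inner_add_left inner_add_right X(2))
    have bounds: "0 \<le> inner (Z x) x \<and> inner (Z x) x \<le> inner x x" for x
    proof -
      have "\<bar>inner (X x) x\<bar> \<le> norm (X x) * norm x" by (rule Cauchy_Schwarz_ineq2)
      also have "\<dots> \<le> (norm x * c) * norm x" by (intro mult_right_mono c) simp
      finally have "\<bar>inner (X x) x\<bar> \<le> c * inner x x"
        by (simp add: power2_norm_eq_inner[symmetric] power2_eq_square algebra_simps)
      then have "\<bar>inner (X x) x\<bar> / c \<le> inner x x" using c(1) by (simp add: field_simps)
      then have "\<bar>inner (X x) x / c\<bar> \<le> inner x x" using c(1) by simp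
      then have "inner (X x) x / c \<le> inner x x" "- (inner (X x) x / c) \<le> inner x x"
        by (simp_all only: abs_le_iff)
      moreover have "inner (Z x) x = (inner (X x) x / c + inner x x) / 2"
        using c(1) by (simp add: Z_def inner_add_left field_simps)
      ultimately show ?thesis by auto
    qed
    have "T (Z v) = Z (T v)"
      by (rule unit) (use bounds Z Z_sym in \<open>auto simp: positive_op_iff Z_def ops_simps[OF S] X(3)\<close>)
    then show ?thesis using c(1) by (simp add: Z_def ops_simps[OF T])
  qed
  note X' = adj_ops[OF X] and inner_X = inner_adj[OF X]
  have inner_X': "inner (adj X x) y = inner x (X y)" for x y
    by (metis inner_X inner_commute)
  have comm': "S (adj X x) = adj X (S x)" for x
    by (rule inner_eq_imp_eq) (simp add: inner_X[symmetric] S_sym[symmetric] comm)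
  have 1: "T (X x + adj X x) = X (T x) + adj X (T x)"
    by (rule self_adjoint[OF ops_plus[OF X X']])
      (simp_all add: inner_add_left inner_add_right inner_X inner_X' ops_simps[OF S] comm comm')
  have 2: "T (\<i> *\<^sub>C (X x - adj X x)) = \<i> *\<^sub>C (X (T x) - adj X (T x))"
    by (rule self_adjoint[OF ops_multC[OF ops_minus[OF X X']]])
      (simp_all add: inner_imaginary_left scaleC_diff_right inner_diff_left inner_diff_right
        inner_X inner_X' ops_simps[OF S] ops_scaleC[OF S] ops_scaleC[OF X] ops_scaleC[OF X'] comm comm')
  from 2 have "\<i> *\<^sub>C T (X x - adj X x) = \<i> *\<^sub>C (X (T x) - adj X (T x))"
    by (simp add: ops_scaleC[OF T])
  then have "T (X x - adj X x) = X (T x) - adj X (T x)"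
    by (simp add: complex_vector.scale_cancel_left)
  with 1 have "T (X x + adj X x) + T (X x - adj X x) = 2 *\<^sub>R X (T x)"
    by (simp add: scaleR_2)
  moreover have "T (X x + adj X x) + T (X x - adj X x) = 2 *\<^sub>R T (X x)"
    by (simp add: ops_simps[OF T] scaleR_2)
  ultimately show ?thesis by simp
qed

section \<open>The bicommutant theorem\<close>

lemma commutant_iff:
  "A \<in> commutant \<S> \<longleftrightarrow> A \<in> \<B> \<and> (\<forall>S\<in>\<S>. \<forall>x. A (S x) = S (A x))"
  by (auto simp: commutant_def fun_eq_iff)

text \<open>Only closure under adjoints is not immediate: moving \<open>A\<close> and
  \<open>S\<close> across the inner product replaces \<open>S\<close> by its adjoint, which again
  lies in the set.\<close>

lemma unital_star_subalgebra_commutant: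
  fixes \<S> :: "('a::complex_hilbert_space \<Rightarrow> 'a) set"
  assumes "\<S> \<subseteq> \<B>" and adj: "\<And>S. S \<in> \<S> \<Longrightarrow> adj S \<in> \<S>"
  shows "unital_star_subalgebra (commutant \<S>)"
proof -
  have S: "S \<in> \<B>" if "S \<in> \<S>" for S using assms(1) that by blast
  have "adj A \<in> commutant \<S>" if A: "A \<in> commutant \<S>" for A
  proof -
    have A': "A \<in> \<B>" "\<And>S x. S \<in> \<S> \<Longrightarrow> A (S x) = S (A x)"
      using A by (auto simp: commutant_iff)
    have "adj A (S x) = S (adj A x)" if "S \<in> \<S>" for S x
    proof (rule inner_eq_imp_eq)
      fix y
      have S': "adj S \<in> \<B>" by (rule adj_ops[OF S[OF that]])
      have swap: "inner u (S v) = inner (adj S u) v" for u v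
        by (simp add: inner_adj[OF S'] adj_adj[OF S[OF that]])
      show "inner y (adj A (S x)) = inner y (S (adj A x))"
        by (simp add: swap inner_adj[OF A'(1), symmetric] A'(2)[OF adj[OF that]])
    qed
    then show ?thesis by (simp add: commutant_iff adj_ops A'(1))
  qed
  moreover have "(\<lambda>x. A (B x)) \<in> commutant \<S>" if "A \<in> commutant \<S>" "B \<in> commutant \<S>" for A B
    using that by (simp add: commutant_iff ops_comp)
  ultimately show ?thesis
    using S by (auto simp: unital_star_subalgebra_def commutant_iff id_def o_def ops_ident
        ops_plus ops_multC ops_simps ops_scaleC)
qed

section \<open>The weak operator topology\<close>

lemma topspace_weak_operator_topology: "topspace weak_operator_topology = \<B>"
proof -
  have "\<B> = {A \<in> \<B>. cinner (A 0) 0 \<in> UNIV}" by simp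
  then show ?thesis
    unfolding weak_operator_topology_def topology_generated_by_topspace by blast
qed

lemma continuous_map_weak_operator:
  "continuous_map weak_operator_topology euclidean (\<lambda>A. cinner (A x) y)"
proof -
  have "openin weak_operator_topology {A \<in> \<B>. cinner (A x) y \<in> U}" if "open U" for U
    unfolding weak_operator_topology_def
    by (rule topology_generated_by_Basis) (use that in blast)
  then show ?thesis
    by (simp add: continuous_map_def topspace_weak_operator_topology)
qed

lemma cinner_adj:
  fixes A :: "'a::complex_hilbert_space \<Rightarrow> 'a"
  assumes "A \<in> \<B>"
  shows "cinner (A x) y = cinner x (adj A y)"
  using inner_adj[OF assms, of x y] inner_adj[OF assms, of "\<i> *\<^sub>C x" y]
  by (simp add: cinner_conv_inner ops_scaleC[OF assms])

text \<open>Putting the outer \<open>S\<close> on the other side as an adjoint writes each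
  commutation defect as a difference of two weakly continuous functionals of the operator.\<close>

lemma closedin_commutant:
  fixes \<S> :: "('a::complex_hilbert_space \<Rightarrow> 'a) set"
  assumes "\<S> \<subseteq> \<B>"
  shows "closedin weak_operator_topology (commutant \<S>)"
  unfolding closedin_def
proof
  show "commutant \<S> \<subseteq> topspace weak_operator_topology"
    by (auto simp: topspace_weak_operator_topology commutant_def)
  show "openin weak_operator_topology (topspace weak_operator_topology - commutant \<S>)"
  proof (subst openin_subopen, intro ballI)
    fix A assume "A \<in> topspace weak_operator_topology - commutant \<S>"
    then have A: "A \<in> \<B>" "A \<notin> commutant \<S>" by (auto simp: topspace_weak_operator_topology)
    then obtain S x where S: "S \<in> \<S>" "A (S x) \<noteq> S (A x)" by (auto simp: commutant_iff)
    \<comment> \<open>Testing the defect against itself gives \<open>f A\<close> the nonzero real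
      part \<open>inner y y\<close>.\<close>
    define y where "y = A (S x) - S (A x)"
    define f where "f = (\<lambda>A. cinner (A (S x)) y - cinner (A x) (adj S y))"
    define U where "U = {B \<in> topspace weak_operator_topology. f B \<in> - {0}}"
    have f: "f B = cinner (B (S x)) y - cinner (S (B x)) y" for B
      using S(1) assms by (auto simp: f_def cinner_adj)
    have "continuous_map weak_operator_topology euclidean f"
      unfolding f_def by (intro continuous_map_diff continuous_map_weak_operator)
    then have "openin weak_operator_topology U"
      unfolding U_def by (rule openin_continuous_map_preimage) (simp add: open_Compl)
    moreover have "A \<in> U"
    proof -
      have "Re (f A) = inner y y"
        by (simp add: f Re_cinner y_def inner_diff_left)
      then show ?thesis using A(1) S(2) by (auto simp: U_def topspace_weak_operator_topology y_def)
    qed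
    moreover have "U \<subseteq> topspace weak_operator_topology - commutant \<S>"
      using S(1) by (auto simp: U_def f commutant_iff)
    ultimately show "\<exists>U. openin weak_operator_topology U \<and> A \<in> U \<and>
        U \<subseteq> topspace weak_operator_topology - commutant \<S>" by blast
  qed
qed

text \<open>The strong operator topology refines the weak one, so approximation in norm on finitely
  many vectors is enough later.\<close>

lemma weak_operator_neighbourhood:
  fixes B :: "'a::complex_inner \<Rightarrow> 'a"
  assumes "openin weak_operator_topology U" "B \<in> U"
  shows "\<exists>F e. finite F \<and> e > 0 \<and> (\<forall>A\<in>\<B>. (\<forall>x\<in>F. norm (A x - B x) < e) \<longrightarrow> A \<in> U)"
proof -
  have "generate_topology_on {{A \<in> \<B>. cinner (A x) y \<in> W} | x y W. open W} U"
    using assms(1) by (simp add: weak_operator_topology_def openin_topology_generated_by_iff)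
  then show ?thesis using assms(2)
  proof (induction rule: generate_topology_on.induct)
    case (Int U V)
    then have "B \<in> U" "B \<in> V" by auto
    from Int.IH(1)[OF this(1)] Int.IH(2)[OF this(2)] obtain F e G d where
      "finite F" "e > 0" "\<forall>A\<in>\<B>. (\<forall>x\<in>F. norm (A x - B x) < e) \<longrightarrow> A \<in> U"
      "finite G" "d > 0" "\<forall>A\<in>\<B>. (\<forall>x\<in>G. norm (A x - B x) < d) \<longrightarrow> A \<in> V"
      by (elim exE conjE)
    then show ?case by (intro exI[of _ "F \<union> G"] exI[of _ "min e d"]) auto
  next
    case (UN K)
    then obtain U where U: "U \<in> K" "B \<in> U" by blast
    with UN.IH obtain F e where
      "finite F" "e > 0" "\<forall>A\<in>\<B>. (\<forall>x\<in>F. norm (A x - B x) < e) \<longrightarrow> A \<in> U" by meson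
    with U(1) show ?case by (intro exI[of _ F] exI[of _ e]) blast
  next
    case (Basis U)
    then obtain x y W where U: "U = {A \<in> \<B>. cinner (A x) y \<in> W}" "open W" by blast
    have "bounded_linear (\<lambda>u. inner (\<i> *\<^sub>C u) y)"
      by (rule bounded_linear_compose[OF bounded_linear_inner_left bounded_linear_scaleC])
    then have "continuous_on UNIV (\<lambda>u. cinner u y)"
      unfolding cinner_conv_inner complex_eq
      by (intro continuous_intros linear_continuous_on)
    then have "open ((\<lambda>u. cinner u y) -` W)"
      using U(2) by (simp add: continuous_on_open_vimage)
    moreover have "B x \<in> (\<lambda>u. cinner u y) -` W" using Basis U by simp
    ultimately obtain e where "e > 0" "\<And>u. dist u (B x) < e \<Longrightarrow> cinner u y \<in> W"
      by (auto simp: open_dist)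
    then show ?case by (intro exI[of _ "{x}"] exI[of _ e]) (auto simp: U dist_norm)
  qed simp
qed

text \<open>\<open>z\<close> is the orthogonal projection of the tuple \<open>(y x)\<^bsub>x \<in> F\<^esub>\<close> onto the closure of
  \<open>{(A x)\<^bsub>x \<in> F\<^esub> | A \<in> \<A>}\<close> in a finite direct sum of copies of the Hilbert space.\<close>

definition is_tuple_projection ::
    "('a::real_inner \<Rightarrow> 'a) set \<Rightarrow> 'a set \<Rightarrow> ('a \<Rightarrow> 'a) \<Rightarrow> ('a \<Rightarrow> 'a) \<Rightarrow> bool" where
  "is_tuple_projection \<A> F y z \<longleftrightarrow>
     (\<exists>k. (\<forall>n::nat. k n \<in> \<A>) \<and> (\<forall>x\<in>F. (\<lambda>n. k n x) \<longlonglongrightarrow> z x)) \<and>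
     (\<forall>A\<in>\<A>. (\<Sum>x\<in>F. inner (y x - z x) (A x)) = 0)"

text \<open>Tuples indexed by \<open>F\<close> are represented by functions on the whole space, so
  projections are determined on \<open>F\<close> only.\<close>

locale star_algebra =
  fixes \<A> :: "('a::complex_hilbert_space \<Rightarrow> 'a) set" and F :: "'a set"
  assumes algebra: "unital_star_subalgebra \<A>" and finite_F: "finite F"
begin

abbreviation "proj \<equiv> is_tuple_projection \<A> F"

lemma mem_ops: "A \<in> \<A> \<Longrightarrow> A \<in> \<B>"
  and mem_id: "(\<lambda>x. x) \<in> \<A>"
  and mem_add: "A \<in> \<A> \<Longrightarrow> B \<in> \<A> \<Longrightarrow> (\<lambda>x. A x + B x) \<in> \<A>"
  and mem_scale: "A \<in> \<A> \<Longrightarrow> (\<lambda>x. c *\<^sub>C A x) \<in> \<A>"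
  and mem_comp: "A \<in> \<A> \<Longrightarrow> B \<in> \<A> \<Longrightarrow> (\<lambda>x. A (B x)) \<in> \<A>"
  and mem_adj: "A \<in> \<A> \<Longrightarrow> adj A \<in> \<A>"
  using algebra by (auto simp: unital_star_subalgebra_def id_def o_def)

lemma proj_exists: "\<exists>z. proj y z"
proof -
  have "(\<lambda>x. 0 *\<^sub>C x) \<in> \<A>" by (rule mem_scale[OF mem_id])
  then have zero: "(\<lambda>x. 0) \<in> \<A>" by simp
  have scale: "(\<lambda>x. r *\<^sub>R A x) \<in> \<A>" if "A \<in> \<A>" for r A
    using mem_scale[OF that, of "complex_of_real r"] by (simp add: scaleC_complex_of_real)
  obtain z k where "\<And>n. k n \<in> \<A>" "\<And>x. x \<in> F \<Longrightarrow> (\<lambda>n::nat. k n x) \<longlonglongrightarrow> z x"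
    "\<And>A. A \<in> \<A> \<Longrightarrow> (\<Sum>x\<in>F. inner (y x - z x) (A x)) = 0"
    by (rule least_squares_approximation[OF finite_F zero mem_add scale, of y]) blast+
  then show ?thesis unfolding is_tuple_projection_def by blast
qed

lemma proj_self:
  assumes "A \<in> \<A>" "\<And>x. x \<in> F \<Longrightarrow> y x = A x"
  shows "proj y A"
  unfolding is_tuple_projection_def using assms by (auto intro!: exI[of _ "\<lambda>_. A"])

lemma proj_add:
  assumes "proj y z" "proj y' z'"
  shows "proj (\<lambda>x. y x + y' x) (\<lambda>x. z x + z' x)"
proof -
  obtain k k' where "\<And>n. k n \<in> \<A>" "\<And>x. x \<in> F \<Longrightarrow> (\<lambda>n. k n x) \<longlonglongrightarrow> z x"
    "\<And>n. k' n \<in> \<A>" "\<And>x. x \<in> F \<Longrightarrow> (\<lambda>n. k' n x) \<longlonglongrightarrow> z' x"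
    using assms unfolding is_tuple_projection_def by blast
  then have "\<exists>k. (\<forall>n::nat. k n \<in> \<A>) \<and> (\<forall>x\<in>F. (\<lambda>n. k n x) \<longlonglongrightarrow> z x + z' x)"
    by (intro exI[of _ "\<lambda>n x. k n x + k' n x"]) (simp add: mem_add tendsto_add)
  moreover have "(\<Sum>x\<in>F. inner (y x + y' x - (z x + z' x)) (A x)) =
      (\<Sum>x\<in>F. inner (y x - z x) (A x)) + (\<Sum>x\<in>F. inner (y' x - z' x) (A x))" for A
    unfolding sum.distrib[symmetric]
    by (rule sum.cong[OF refl]) (simp add: inner_add_left inner_diff_left)
  ultimately show ?thesis
    using assms unfolding is_tuple_projection_def by simp
qed

text \<open>The projection commutes with the diagonal action of the algebra: closure under adjoints
  makes the orthogonal complement of the tuple space invariant too.\<close>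

lemma proj_apply:
  assumes "proj y z" "A \<in> \<A>"
  shows "proj (\<lambda>x. A (y x)) (\<lambda>x. A (z x))"
proof -
  note A = mem_ops[OF assms(2)]
  obtain k where "\<And>n. k n \<in> \<A>" "\<And>x. x \<in> F \<Longrightarrow> (\<lambda>n. k n x) \<longlonglongrightarrow> z x"
    using assms unfolding is_tuple_projection_def by blast
  then have "\<exists>k. (\<forall>n::nat. k n \<in> \<A>) \<and> (\<forall>x\<in>F. (\<lambda>n. k n x) \<longlonglongrightarrow> A (z x))"
    by (intro exI[of _ "\<lambda>n x. A (k n x)"]) (simp add: mem_comp assms(2) ops_tendsto[OF A])
  moreover have "(\<Sum>x\<in>F. inner (A (y x) - A (z x)) (B x)) = 0" if "B \<in> \<A>" for B
    using assms(1) mem_comp[OF mem_adj[OF assms(2)] that]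
    by (simp add: is_tuple_projection_def ops_simps(3)[OF A, symmetric] inner_adj[OF A])
  ultimately show ?thesis unfolding is_tuple_projection_def by simp
qed

lemma proj_scale: "proj y z \<Longrightarrow> proj (\<lambda>x. c *\<^sub>C y x) (\<lambda>x. c *\<^sub>C z x)"
  using proj_apply[OF _ mem_scale[OF mem_id]] .

lemma proj_zero: "proj (\<lambda>x. 0) (\<lambda>x. 0)"
proof -
  obtain z where "proj (\<lambda>x. 0) z" using proj_exists by blast
  from proj_scale[OF this, of 0] show ?thesis by simp
qed

lemma proj_sum:
  assumes "finite G" "\<And>v. v \<in> G \<Longrightarrow> proj (y v) (z v)"
  shows "proj (\<lambda>x. \<Sum>v\<in>G. y v x) (\<lambda>x. \<Sum>v\<in>G. z v x)"
  using assms by (induction rule: finite_induct) (simp_all add: proj_zero proj_add)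

text \<open>Pythagoras, once orthogonality to the approximants \<open>k n\<close> has passed to
  their limit \<open>z\<close>.\<close>

lemma proj_contraction:
  assumes "proj y z"
  shows "(\<Sum>x\<in>F. (norm (z x))\<^sup>2) \<le> (\<Sum>x\<in>F. (norm (y x))\<^sup>2)"
proof -
  obtain k where k: "\<And>n. k n \<in> \<A>" "\<And>x. x \<in> F \<Longrightarrow> (\<lambda>n::nat. k n x) \<longlonglongrightarrow> z x"
    using assms unfolding is_tuple_projection_def by blast
  have "(\<lambda>n. \<Sum>x\<in>F. inner (y x - z x) (k n x)) \<longlonglongrightarrow> (\<Sum>x\<in>F. inner (y x - z x) (z x))"
    by (intro tendsto_intros k)
  moreover have "(\<Sum>x\<in>F. inner (y x - z x) (k n x)) = 0" for n
    using assms k(1) unfolding is_tuple_projection_def by blast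
  ultimately have "(\<Sum>x\<in>F. inner (y x - z x) (z x)) = 0"
    by (simp add: LIMSEQ_const_iff)
  moreover have "(norm (y x))\<^sup>2 = (norm (z x))\<^sup>2 + 2 * inner (y x - z x) (z x) + (norm (y x - z x))\<^sup>2" for x
    unfolding power2_norm_eq_inner by (simp add: algebra_simps inner_commute)
  ultimately have "(\<Sum>x\<in>F. (norm (y x))\<^sup>2) =
      (\<Sum>x\<in>F. (norm (z x))\<^sup>2) + (\<Sum>x\<in>F. (norm (y x - z x))\<^sup>2)"
    by (simp add: sum.distrib sum_distrib_left[symmetric])
  then show ?thesis by (simp add: sum_nonneg)
qed

text \<open>By linearity and contractivity, the difference of the two projections is bounded by a
  tuple that vanishes on \<open>F\<close>.\<close>

lemma proj_unique:
  assumes "proj y z" "proj y' z'" "\<And>x. x \<in> F \<Longrightarrow> y x = y' x" "x \<in> F"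
  shows "z x = z' x"
proof -
  have "(\<Sum>x\<in>F. (norm (z x + (-1) *\<^sub>C z' x))\<^sup>2) \<le> (\<Sum>x\<in>F. (norm (y x + (-1) *\<^sub>C y' x))\<^sup>2)"
    by (intro proj_contraction proj_add proj_scale assms(1,2))
  then have "(\<Sum>x\<in>F. (norm (z x - z' x))\<^sup>2) \<le> 0"
    using assms(3) by (simp add: scaleC_uminus_left scaleC_one)
  then have "(\<Sum>x\<in>F. (norm (z x - z' x))\<^sup>2) = 0"
    by (intro antisym sum_nonneg) auto
  then show ?thesis
    using \<open>x \<in> F\<close> finite_F by (simp add: sum_nonneg_eq_0_iff)
qed

definition tuple_projection :: "('a \<Rightarrow> 'a) \<Rightarrow> 'a \<Rightarrow> 'a" where
  "tuple_projection y = (SOME z. proj y z)"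

lemma proj_tuple_projection: "proj y (tuple_projection y)"
  unfolding tuple_projection_def by (rule someI_ex[OF proj_exists])

text \<open>The entry in row \<open>u\<close> and column \<open>v\<close> of the operator matrix of
  the tuple projection.\<close>

definition entry :: "'a \<Rightarrow> 'a \<Rightarrow> 'a \<Rightarrow> 'a" where
  "entry u v h = tuple_projection (\<lambda>x. if x = v then h else 0) u"

lemma proj_entry: "proj (\<lambda>x. if x = v then h else 0) (\<lambda>u. entry u v h)"
  unfolding entry_def by (rule proj_tuple_projection)

text \<open>A matrix commuting with all diagonal operators \<open>diag(A,...,A)\<close> has entries
  commuting with \<open>A\<close>.\<close>

lemma entry_commutant:
  assumes "u \<in> F" "v \<in> F"
  shows "entry u v \<in> commutant \<A>"
proof -
  have "entry u v \<in> \<B>"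
  proof (rule bounded_opsI[where K = 1])
    show "entry u v (g + h) = entry u v g + entry u v h" for g h
      by (rule proj_unique[OF proj_entry proj_add[OF proj_entry proj_entry] _ assms(1)]) simp
    show "entry u v (c *\<^sub>C h) = c *\<^sub>C entry u v h" for c h
      by (rule proj_unique[OF proj_entry proj_scale[OF proj_entry] _ assms(1)]) simp
    show "norm (entry u v h) \<le> norm h * 1" for h
    proof (rule power2_le_imp_le)
      have "(norm (entry u v h))\<^sup>2 \<le> (\<Sum>x\<in>F. (norm (entry x v h))\<^sup>2)"
        using assms(1) finite_F by (intro member_le_sum[where f = "\<lambda>x. (norm (entry x v h))\<^sup>2"]) auto
      also have "\<dots> \<le> (\<Sum>x\<in>F. (norm (if x = v then h else 0))\<^sup>2)"
        by (rule proj_contraction[OF proj_entry])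
      also have "\<dots> = (\<Sum>x\<in>F. if x = v then (norm h)\<^sup>2 else 0)"
        by (rule sum.cong) auto
      also have "\<dots> = (norm h)\<^sup>2" using assms(2) finite_F by simp
      finally show "(norm (entry u v h))\<^sup>2 \<le> (norm h * 1)\<^sup>2" by simp
    qed simp
  qed
  moreover have "entry u v (A h) = A (entry u v h)" if "A \<in> \<A>" for A h
    by (rule proj_unique[OF proj_entry proj_apply[OF proj_entry that] _ assms(1)])
      (simp add: ops_simps(1)[OF mem_ops[OF that]])
  ultimately show ?thesis by (simp add: commutant_iff)
qed

text \<open>The identity tuple is fixed by the projection matrix. \<open>B\<close> commutes with
  every entry, so applying \<open>B\<close> shows that the tuple of its values is fixed as well,
  hence a limit of tuples from the algebra.\<close>

lemma proj_bicommutant: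
  assumes "B \<in> commutant (commutant \<A>)"
  shows "proj B B"
proof -
  have B: "B \<in> \<B>" using assms by (simp add: commutant_iff)
  have eq: "B x = (\<Sum>v\<in>F. entry x v (B v))" if "x \<in> F" for x
  proof -
    have "x = (\<Sum>v\<in>F. entry x v v)"
      by (rule proj_unique[OF proj_self[OF mem_id refl] proj_sum[OF finite_F proj_entry] _ that])
        (simp add: finite_F)
    then have "B x = (\<Sum>v\<in>F. B (entry x v v))" by (metis ops_simps(6)[OF B])
    also have "\<dots> = (\<Sum>v\<in>F. entry x v (B v))"
      using assms entry_commutant[OF that] by (intro sum.cong) (auto simp: commutant_iff)
    finally show ?thesis .
  qed
  have "proj (\<lambda>x. \<Sum>v\<in>F. if x = v then B v else 0) (\<lambda>x. \<Sum>v\<in>F. entry x v (B v))"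
    by (rule proj_sum[OF finite_F proj_entry])
  then show ?thesis
    using finite_F unfolding is_tuple_projection_def by (simp add: eq)
qed

end

text \<open>If \<open>B\<close> were outside, some strong neighbourhood of \<open>B\<close> would
  miss the algebra, although the algebra approximates \<open>B\<close> on every finite set of
  vectors.\<close>

lemma bicommutant_von_neumann_algebra:
  fixes \<A> :: "('a::complex_hilbert_space \<Rightarrow> 'a) set"
  assumes "von_neumann_algebra \<A>"
  shows "commutant (commutant \<A>) \<subseteq> \<A>"
proof
  fix B assume B: "B \<in> commutant (commutant \<A>)"
  have algebra: "unital_star_subalgebra \<A>" and closed: "closedin weak_operator_topology \<A>"
    using assms by (auto simp: von_neumann_algebra_def)
  show "B \<in> \<A>"
  proof (rule ccontr)
    assume "B \<notin> \<A>"
    then have "B \<in> topspace weak_operator_topology - \<A>"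
      using B by (simp add: topspace_weak_operator_topology commutant_iff)
    then obtain F e where F: "finite F" "e > 0"
      "\<And>A. A \<in> \<B> \<Longrightarrow> \<forall>x\<in>F. norm (A x - B x) < e \<Longrightarrow> A \<in> topspace weak_operator_topology - \<A>"
      using weak_operator_neighbourhood closed unfolding closedin_def by metis
    interpret star_algebra \<A> F by unfold_locales (rule algebra F)+
    obtain k where k: "\<And>n. k n \<in> \<A>" "\<And>x. x \<in> F \<Longrightarrow> (\<lambda>n::nat. k n x) \<longlonglongrightarrow> B x"
      using proj_bicommutant[OF B] unfolding is_tuple_projection_def by blast
    have "\<forall>\<^sub>F n in sequentially. \<forall>x\<in>F. norm (k n x - B x) < e"
      using k(2) F(2) by (intro eventually_ball_finite[OF F(1)]) (auto simp: tendsto_iff dist_norm)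
    then obtain n where "\<forall>x\<in>F. norm (k n x - B x) < e" by (auto simp: eventually_sequentially)
    then show False using F(3)[OF mem_ops[OF k(1)]] k(1) by blast
  qed
qed

text \<open>The bicommutant is itself a von Neumann algebra containing \<open>A\<close>. Minimality
  holds because taking commutants twice is monotone and gives back nothing outside a von Neumann
  algebra.\<close>

lemma generated_von_neumann_algebra_eq_bicommutant:
  fixes A :: "'a::complex_hilbert_space \<Rightarrow> 'a"
  assumes "A \<in> \<B>" "adj A = A"
  shows "W\<^sup>* A = commutant (commutant {A})"
proof
  have C: "unital_star_subalgebra (commutant {A})"
    by (rule unital_star_subalgebra_commutant) (use assms in auto)
  then have "commutant {A} \<subseteq> \<B>" "\<And>B. B \<in> commutant {A} \<Longrightarrow> adj B \<in> commutant {A}"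
    by (auto simp: unital_star_subalgebra_def)
  then have "von_neumann_algebra (commutant (commutant {A}))"
    unfolding von_neumann_algebra_def
    by (intro conjI unital_star_subalgebra_commutant closedin_commutant)
  moreover have "A \<in> commutant (commutant {A})"
    using assms(1) by (simp add: commutant_iff)
  ultimately show "W\<^sup>* A \<subseteq> commutant (commutant {A})"
    unfolding generated_von_neumann_algebra_def by blast
  show "commutant (commutant {A}) \<subseteq> W\<^sup>* A"
    unfolding generated_von_neumann_algebra_def
  proof (rule Inter_greatest, clarify)
    fix \<A> B assume \<A>: "von_neumann_algebra \<A>" "A \<in> \<A>" and B: "B \<in> commutant (commutant {A})"
    then have "B \<in> commutant (commutant \<A>)" by (auto simp: commutant_iff)
    then show "B \<in> \<A>" using bicommutant_von_neumann_algebra[OF \<A>(1)] by blast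
  qed
qed

section \<open>Polar decompositions\<close>

lemma adj_comp_self_positive:
  assumes "T \<in> \<B>"
  shows "positive_op (adj T \<circ> T)"
proof -
  note T' = adj_ops[OF assms]
  have "inner (adj T u) v = inner u (T v)" for u v
    by (simp add: inner_adj[OF T'] adj_adj[OF assms])
  then show ?thesis
    using ops_comp[OF T' assms] by (simp add: positive_op_iff o_def inner_adj[OF assms])
      (simp add: inner_adj[OF assms, symmetric])
qed

theorem theorem7p4:
  fixes T V :: "'a::complex_hilbert_space \<Rightarrow> 'a"
  assumes "infinite_dimensional TYPE('a)"
    and "separable_space (euclidean :: 'a topology)"
    and "T \<in> \<B>"
    and "polar_decomposition T V"
  shows "(reducing_subspaces T = reducing_subspaces (abs_op T) \<longleftrightarrow> V \<in> W\<^sup>* (abs_op T)) \<and>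
         W\<^sup>* (abs_op T) = commutant (commutant {abs_op T})"
proof -
  note T = \<open>T \<in> \<B>\<close>
  define S where "S = abs_op T"
  note pos = adj_comp_self_positive[OF T]
  note S = positive_opD[OF positive_sqrt_op[OF pos], folded abs_op_def, folded S_def]
  have SS: "S (S x) = adj T (T x)" for x
    using sqrt_op_sqrt_op[OF pos] by (simp add: S_def abs_op_def)
  have comm_S: "X (S x) = S (X x)" if "X \<in> \<B>" "\<And>x. X (adj T (T x)) = adj T (T (X x))" for X x
    unfolding S_def abs_op_def by (rule sqrt_op_commutes[OF pos that(1)]) (simp add: that(2))
  have V: "V \<in> \<B>" and TVS: "\<And>x. T x = V (S x)" and ker_V: "\<And>x. V x = 0 \<longleftrightarrow> T x = 0"
    using assms(4) by (auto simp: polar_decomposition_def partial_isometry_def op_kernel_def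
        S_def fun_eq_iff)
  \<comment> \<open>Symmetry of \<open>S\<close> and \<open>S^2 = T*T\<close> turn the squared norm
    of \<open>S x\<close> into \<open>inner x (adj T (T x))\<close>.\<close>
  have ker_S: "T x = 0 \<longleftrightarrow> S x = 0" for x
  proof
    assume "T x = 0"
    then have "inner (S x) (S x) = 0" by (simp add: S(2) SS ops_simps[OF adj_ops[OF T]])
    then show "S x = 0" by simp
  qed (simp add: TVS ops_simps[OF V])
  have red_T_S: "reducing_subspaces T \<subseteq> reducing_subspaces S"
  proof
    fix M assume M: "M \<in> reducing_subspaces T"
    then have M': "closed M" "complex_vector.subspace M" "M \<in> reducing_subspaces (adj T)"
      by (auto simp: reducing_subspaces_def adj_adj[OF T])
    have "T (orth_proj M x) = orth_proj M (T x)" "adj T (orth_proj M x) = orth_proj M (adj T x)" for x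
      using M M' reducing_iff_commutes[OF T] reducing_iff_commutes[OF adj_ops[OF T]] by blast+
    then have "orth_proj M (S x) = S (orth_proj M x)" for x
      by (intro comm_S orth_proj_ops M') simp
    then show "M \<in> reducing_subspaces S"
      by (simp add: reducing_iff_commutes[OF S(1)] M')
  qed
  have W: "W\<^sup>* S = commutant (commutant {S})"
    by (rule generated_von_neumann_algebra_eq_bicommutant[OF S(1) adj_eq_self[OF S(1,2)]])
  have "V \<in> commutant (commutant {S})" if "reducing_subspaces T = reducing_subspaces S"
  proof (subst commutant_iff, intro conjI ballI allI V)
    fix X x assume "X \<in> commutant {S}"
    then have X: "X \<in> \<B>" "\<And>x. X (S x) = S (X x)" by (auto simp: commutant_iff)
    have "T (X x) = X (T x)" for x
      using commutes_if_commutes_projections[OF S(1,2) T _ X(1)] X(2) that by simp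
    then have range: "V (X (S x)) = X (V (S x))" for x
      by (simp add: TVS X(2))
    \<comment> \<open>The set where \<open>V\<close> and \<open>X\<close> commute is a closed
      subspace containing the range of \<open>S\<close>. The component \<open>d\<close> of
      \<open>x\<close> orthogonal to it lies in the kernel of \<open>S\<close>, which is that of
      \<open>V\<close> and is preserved by \<open>X\<close>; so \<open>d\<close> is in
      \<open>M\<close> too.\<close>
    define M where "M = {x. V (X x) = X (V x)}"
    have M: "closed M" "complex_vector.subspace M"
    proof -
      have "continuous_on UNIV (\<lambda>x. V (X x))" "continuous_on UNIV (\<lambda>x. X (V x))"
        using linear_continuous_on[OF ops_bounded_linear[OF ops_comp[OF V X(1)]]]
          linear_continuous_on[OF ops_bounded_linear[OF ops_comp[OF X(1) V]]] .
      then show "closed M" unfolding M_def by (rule closed_Collect_eq)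
      show "complex_vector.subspace M"
        by (auto simp: M_def complex_vector.subspace_def ops_simps[OF V] ops_simps[OF X(1)]
            ops_scaleC[OF V] ops_scaleC[OF X(1)])
    qed
    define d where "d = x - orth_proj M x"
    have "inner (S d) y = 0" for y
    proof -
      have "S y \<in> M" by (simp add: M_def range)
      then show ?thesis by (simp add: S(2) d_def orth_proj_orth[OF M])
    qed
    then have d: "S d = 0" using inner_eq_zero_iff by blast
    then have "S (X d) = 0" using X(2)[of d] by (simp add: ops_simps[OF X(1)])
    then have "V d = 0" "V (X d) = 0" using d by (simp_all only: ker_V ker_S)
    then have "d \<in> M" by (simp add: M_def ops_simps[OF X(1)])
    moreover have "x = orth_proj M x + d" by (simp add: d_def)
    ultimately have "x \<in> M"
      using complex_vector.subspace_add[OF M(2) orth_proj_in[OF M]] by metis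
    then show "V (X x) = X (V x)" by (simp add: M_def)
  qed
  moreover have "reducing_subspaces S \<subseteq> reducing_subspaces T" if "V \<in> commutant (commutant {S})"
  proof
    fix M assume M: "M \<in> reducing_subspaces S"
    then have M': "closed M" "complex_vector.subspace M" by (auto simp: reducing_subspaces_def)
    have comm: "S (orth_proj M x) = orth_proj M (S x)" for x
      using M M' reducing_iff_commutes[OF S(1)] by blast
    \<comment> \<open>The projection lies in the commutant of \<open>S\<close>, so \<open>V\<close>
      commutes with it, and hence so does \<open>T = V S\<close>.\<close>
    then have "orth_proj M \<in> commutant {S}"
      by (simp add: commutant_iff orth_proj_ops M')
    with that have "V (orth_proj M x) = orth_proj M (V x)" for x
      by (auto simp: commutant_iff)
    then show "M \<in> reducing_subspaces T"
      by (simp add: reducing_iff_commutes[OF T] M' TVS comm)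
  qed
  ultimately show ?thesis
    using red_T_S W unfolding S_def[symmetric] by blast
qed

end
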